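(* For every integer $m\ge 1$, $$ \pi^{4m+1} = -\frac{4^{2m}}{E_m}\, S_{4m+1}(1) + \frac{2K_m\left[2^{4m+1}-(-4)^m+1\right]}{E_m}\, S_{4m+1}(2) + \frac{1-4K_m}{E_m}\, S_{4m+1}(4). $$
   Context: For a positive integer $n$ and real $r>0$, $S_n(r)=\sum_{k=1}^{\infty}\frac{1}{k^n(e^{\pi r k}-1)}$. The Bernoulli numbers $B_k$ are defined by $\frac{x}{e^x-1}=\sum_{n=0}^\infty \frac{B_n x^n}{n!}$ for $|x|<2\pi$. For a nonnegative integer $n$, $$G_n=\sum_{k=0}^{n+1}(-4)^k\frac{B_{2k}B_{2n+2-2k}}{(2k)!(2n+2-2k)!},\qquad H_n=\sum_{k=0}^{n}(-4)^{n+k}\frac{B_{4k}B_{4n+2-4k}}{(4k)!(4n+2-4k)!}.$$ For an integer $m\ge 1$, $$K_m=\frac{\frac12(1-4^{2m})}{1+(-4)^m-2^{4m+1}},\qquad E_m=\frac{4^{2m}}{2}G_{2m}-2^{4m+1}K_mH_m-2^{4m}K_mG_{2m}.$$ *)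

theory Defs
  imports "HOL-Complex_Analysis.Complex_Analysis"
begin

definition S_series :: "nat \<Rightarrow> real \<Rightarrow> real" where
  "S_series n r = (\<Sum>k. 1 / (real (Suc k) ^ n * (exp (pi * r * real (Suc k)) - 1)))"

lemma summable_S_series:
  assumes "r > 0"
  shows "summable (\<lambda>k. 1 / (real (Suc k) ^ n * (exp (pi * r * real (Suc k)) - 1)))"
proof (rule summable_comparison_test)
  define c where "c = 1 - exp (- (pi * r))"
  have c: "c > 0" using assms by (simp add: c_def)
  show "summable (\<lambda>k. (1 / c) * exp (- (pi * r)) ^ k)"
    using assms by (intro summable_mult summable_geometric) auto
  have "norm (1 / (real (Suc k) ^ n * (exp (pi * r * real (Suc k)) - 1)))
      \<le> (1 / c) * exp (- (pi * r)) ^ k" for k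
  proof -
    define a where "a = exp (pi * r)"
    have a: "a > 1" using assms by (simp add: a_def)
    have ek: "exp (pi * r * real (Suc k)) = a ^ Suc k"
      unfolding a_def exp_of_nat_mult [symmetric] by (simp add: mult_ac)
    have c_eq: "c = 1 - 1 / a" by (simp add: c_def a_def exp_minus field_simps)
    have "a ^ k \<ge> 1" using a by simp
    have "c * a ^ k \<le> a ^ k - 1 / a"
      using a \<open>a ^ k \<ge> 1\<close> by (simp add: c_eq field_simps)
    also have "\<dots> \<le> a * (a ^ k - 1 / a)"
    proof -
      have "1 / a \<le> 1" using a by simp
      hence "0 \<le> a ^ k - 1 / a" using \<open>a ^ k \<ge> 1\<close> by linarith
      thus ?thesis using mult_right_mono[of 1 a "a ^ k - 1 / a"] a by simp
    qed
    also have "\<dots> = a ^ Suc k - 1" using a by (simp add: field_simps)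
    finally have 1: "c * a ^ k \<le> a ^ Suc k - 1" .
    have p: "0 < c * a ^ k" using c a by simp
    have 2: "(1::real) \<le> real (Suc k) ^ n" by (rule one_le_power) simp
    have "c * a ^ k \<le> real (Suc k) ^ n * (a ^ Suc k - 1)"
      using mult_mono[OF 2 1] p by simp
    hence "1 / (real (Suc k) ^ n * (a ^ Suc k - 1)) \<le> 1 / (c * a ^ k)"
      using p by (intro divide_left_mono mult_pos_pos[of _ "c * a ^ k"]) (assumption | linarith)+
    moreover have "0 \<le> real (Suc k) ^ n * (a ^ Suc k - 1)"
      using \<open>c * a ^ k \<le> real (Suc k) ^ n * (a ^ Suc k - 1)\<close> p by linarith
    moreover have "exp (- (pi * r)) ^ k = 1 / a ^ k"
      by (simp add: a_def exp_minus power_inverse divide_inverse)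
    ultimately show ?thesis
      unfolding ek by (simp add: abs_of_nonneg)
  qed
  thus "\<exists>N. \<forall>k\<ge>N. norm (1 / (real (Suc k) ^ n * (exp (pi * r * real (Suc k)) - 1)))
      \<le> (1 / c) * exp (- (pi * r)) ^ k" by blast
qed

text \<open>
  The quotient is taken in the ring of formal power series, where it is exact: the numerator and the
  denominator both have order 1 at 0. The theorem \<open>bernoulli_sums_complex\<close> below shows that
  these numbers satisfy the analytic defining equation on the disc of radius \<open>2 * pi\<close>.
\<close>

definition bernoulli :: "nat \<Rightarrow> real" where
  "bernoulli n = fact n * fps_nth (fps_X / (fps_exp 1 - 1)) n"

lemma exp_eq_1_imp_zero:
  fixes z :: complex
  assumes "exp z = 1" "norm z < 2 * pi"
  shows "z = 0"
proof -
  from assms(1) obtain n :: int where n: "Re z = 0" "Im z = of_int (2 * n) * pi"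
    by (auto simp: exp_eq_1)
  have "\<bar>of_int (2 * n) * pi\<bar> < 2 * pi"
    using abs_Im_le_cmod[of z] assms(2) n by linarith
  hence "\<bar>of_int n :: real\<bar> < 1" by (simp add: abs_mult)
  hence "n = 0" by linarith
  with n show ?thesis by (simp add: complex_eq_iff)
qed

theorem bernoulli_sums_complex:
  fixes z :: complex
  assumes "norm z < 2 * pi"
  shows "(\<lambda>n. of_real (bernoulli n) * z ^ n / fact n) sums (if z = 0 then 1 else z / (exp z - 1))"
proof -
  let ?f = "\<lambda>z::complex. if z = 0 then 1 else z / (exp z - 1)"
  let ?G = "fps_exp 1 - 1 :: complex fps"
  have sub: "subdegree ?G = 1" by (rule subdegreeI) auto
  have fps: "?f has_fps_expansion fps_X / ?G"
    by (intro has_fps_expansion_divide fps_expansion_intros)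
       (use sub in \<open>auto simp del: minus_diff_eq\<close>)
  have hol: "?f holomorphic_on ball 0 (2 * pi)"
  proof (rule no_isolated_singularity'[where K = "{0}"])
    show "?f holomorphic_on ball 0 (2 * pi) - {0}"
    proof (rule holomorphic_transform)
      show "(\<lambda>z. z / (exp z - 1)) holomorphic_on ball 0 (2 * pi) - {0}"
        using exp_eq_1_imp_zero by (intro holomorphic_intros) auto
    qed auto
    fix w :: complex assume "w \<in> {0}"
    thus "(?f \<longlongrightarrow> ?f w) (at w within ball 0 (2 * pi))"
      using has_fps_expansion_imp_continuous[OF fps]
      by (auto simp: continuous_within)
  qed auto
  have "(\<lambda>n. fps_nth (fps_X / ?G) n * z ^ n) sums ?f z"
    by (rule has_fps_expansion_imp_sums_complex[OF fps, where r = "ereal (2 * pi)"])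
       (use assms hol in auto)
  moreover have "fps_nth (fps_X / ?G) n = of_real (bernoulli n) / fact n" for n
  proof -
    let ?R = "fps_exp 1 - 1 :: real fps"
    define Q where "Q = fps_X / ?R"
    define P where "P = Abs_fps (\<lambda>n. complex_of_real (fps_nth Q n))"
    have "subdegree ?R = 1" by (rule subdegreeI) auto
    hence "?R dvd fps_X" by (subst fps_dvd_iff) auto
    hence Q: "Q * ?R = fps_X" by (simp add: Q_def)
    have "P * ?G = fps_X"
    proof (rule fps_ext)
      fix n
      have "fps_nth (P * ?G) n = of_real (fps_nth (Q * ?R) n)"
        by (simp add: fps_mult_nth P_def if_distrib cong: if_cong)
      thus "fps_nth (P * ?G) n = fps_nth fps_X n" by (simp add: Q fps_X_def)
    qed
    moreover have "?G \<noteq> 0" using sub by force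
    ultimately have "fps_X / ?G = P" by (metis nonzero_mult_div_cancel_right)
    thus ?thesis by (simp add: P_def Q_def bernoulli_def)
  qed
  ultimately show ?thesis by simp
qed

corollary bernoulli_sums_real:
  fixes x :: real
  assumes "\<bar>x\<bar> < 2 * pi" "x \<noteq> 0"
  shows "(\<lambda>n. bernoulli n * x ^ n / fact n) sums (x / (exp x - 1))"
proof -
  have "(\<lambda>n. complex_of_real (bernoulli n * x ^ n / fact n)) sums of_real (x / (exp x - 1))"
    using bernoulli_sums_complex[of "of_real x"] assms by (simp add: exp_of_real)
  thus ?thesis by (simp only: sums_of_real_iff)
qed

definition G_sum :: "nat \<Rightarrow> real" where
  "G_sum n = (\<Sum>k=0..n+1. (-4) ^ k * (bernoulli (2*k) * bernoulli (2*n + 2 - 2*k))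
            / (fact (2*k) * fact (2*n + 2 - 2*k)))"

definition H_sum :: "nat \<Rightarrow> real" where
  "H_sum n = (\<Sum>k=0..n. (-4) ^ (n + k) * (bernoulli (4*k) * bernoulli (4*n + 2 - 4*k))
            / (fact (4*k) * fact (4*n + 2 - 4*k)))"

definition K_coeff :: "nat \<Rightarrow> real" where
  "K_coeff m = (1/2 * (1 - 4 ^ (2*m))) / (1 + (-4) ^ m - 2 ^ (4*m + 1))"

definition E_coeff :: "nat \<Rightarrow> real" where
  "E_coeff m = 4 ^ (2*m) / 2 * G_sum (2*m) - 2 ^ (4*m + 1) * K_coeff m * H_sum m
              - 2 ^ (4*m) * K_coeff m * G_sum (2*m)"

end

(* The partial fraction expansion of the cotangent turns C(t) = sum_k cot(pi k t) / k^(2N+1) into a double sum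
   over 1 / (k^(2N) (k^2 t^2 - j^2)), and splitting that summand further by partial fractions exchanges the roles
   of k and j. This relates C(t) to C(-1/t) up to products of even zeta values, i.e. of Bernoulli numbers.
   The point t = 2i relates S_n(4) to S_n(1), and t = -1 + i relates S_n(2) to
   R = sum_k 1 / (k^n ((-1)^k e^(pi k) - 1)). A third relation, between R and S_n(1), S_n(2), S_n(4), comes from
   splitting R by the parity of k. Eliminating R and zeta(n) yields the formula multiplied by E_m, and
   the sum S_n(1) dominates the others, which gives E_m < 0. *)
theory Submission
  imports Defs
begin

text \<open>Exchanging the roles of k and j needs absolute convergence, and this fixes the region:
  if Re \<tau>^2 <= 0, then k^2 \<tau>^2 - j^2 has modulus at least j^2, uniformly in k. The map
  \<tau> -> -1/\<tau> preserves the region; 2i lies in it and -1 + i on its boundary. At these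
  points and at their images i/2 and (1 + i)/2 the numbers exp(-2 pi i k \<tau>) are real, so the
  cotangent series become real series up to a factor i. Only N = 2m occurs, so \<tau>^(2N) is a
  power of \<tau>^4: it is w = (-4)^m at -1 + i and 16^m = w^2 at 2i. Hence zeta(n), n = 4m + 1, has
  coefficient 1 - w^2 in one relation and 1 - w in the other, and 1 + w times the second cancels it
  from the first. After cancelling 1 - w, K_m = (1 + w) / (2 (1 + 2w)) is this multiplier in
  normalised form. That E_m is nonzero has to be proved: since x / 0 = 0, the right-hand side would
  otherwise be 0.\<close>

section \<open>Partial fractions of the cotangent\<close>

lemma cot_conv_exp:
  fixes z :: complex
  shows "cot z = \<i> * (exp (2 * \<i> * z) + 1) / (exp (2 * \<i> * z) - 1)"
proof -
  define u where "u = exp (\<i> * z)"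
  have u: "u \<noteq> 0" "exp (2 * \<i> * z) = u\<^sup>2" "exp (- (\<i> * z)) = inverse u"
    by (simp_all add: u_def exp_double [symmetric] exp_minus mult_ac)
  have "cot z = \<i> * ((u + inverse u) / (u - inverse u))"
  proof -
    \<comment> \<open>The case \<open>b = 0\<close> is a pole of cot, where both sides are 0 because
      x / 0 = 0.\<close>
    have "(a / 2) / (b / (2 * \<i>)) = \<i> * (a / b)" for a b :: complex
      by (cases "b = 0") (auto simp: divide_simps)
    thus ?thesis
      by (simp add: cot_def cos_exp_eq sin_exp_eq u_def [symmetric] u(3) del: divide_divide_eq_right divide_divide_eq_left)
  qed
  also have "(u + inverse u) / (u - inverse u) = (u\<^sup>2 + 1) / (u\<^sup>2 - 1)"
  proof -
    have "(u + inverse u) / (u - inverse u) = (u * (u + inverse u)) / (u * (u - inverse u))"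
      using u(1) by simp
    also have "\<dots> = (u\<^sup>2 + 1) / (u\<^sup>2 - 1)"
      using u(1) by (simp add: algebra_simps power2_eq_square)
    finally show ?thesis .
  qed
  finally show ?thesis by (simp add: u(2))
qed

text \<open>Logarithmic derivative of Euler's reflection formula Gamma(z) Gamma(1 - z) = pi / sin(pi
  z).\<close>

lemma Digamma_reflection:
  fixes z :: complex
  assumes "z \<notin> \<int>"
  shows "Digamma (1 - z) - Digamma z = of_real pi * cot (of_real pi * z)"
proof -
  have s: "sin (of_real pi * z) \<noteq> 0"
    using assms by (auto simp: sin_eq_0 mult.commute)
  have z1: "z \<notin> \<int>\<^sub>\<le>\<^sub>0" "1 - z \<notin> \<int>\<^sub>\<le>\<^sub>0"
    using assms nonpos_Ints_subset_Ints Ints_diff[of 1 "1 - z"] by auto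
  have "((\<lambda>w. Gamma w * Gamma (1 - w)) has_field_derivative
      Gamma z * Gamma (1 - z) * (Digamma z - Digamma (1 - z))) (at z)"
    using z1 by (auto intro!: derivative_eq_intros simp: algebra_simps)
  moreover have "((\<lambda>w. of_real pi / sin (of_real pi * w)) has_field_derivative
      - (of_real pi * (of_real pi * cos (of_real pi * z)) / (sin (of_real pi * z))\<^sup>2)) (at z)"
    using s by (auto intro!: derivative_eq_intros simp: power2_eq_square)
  ultimately have "Gamma z * Gamma (1 - z) * (Digamma z - Digamma (1 - z)) =
      - (of_real pi * (of_real pi * cos (of_real pi * z)) / (sin (of_real pi * z))\<^sup>2)"
    unfolding Gamma_reflection_complex by (rule DERIV_unique)
  hence "- (of_real pi / sin (of_real pi * z) * (Digamma z - Digamma (1 - z))) =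
      of_real pi / sin (of_real pi * z) * (of_real pi * cot (of_real pi * z))"
    by (simp add: Gamma_reflection_complex cot_def power2_eq_square)
  hence "of_real pi / sin (of_real pi * z) * (Digamma (1 - z) - Digamma z) =
      of_real pi / sin (of_real pi * z) * (of_real pi * cot (of_real pi * z))"
    by (metis minus_diff_eq mult_minus_right)
  moreover have "of_real pi / sin (of_real pi * z) \<noteq> (0 :: complex)"
    using s by simp
  ultimately show ?thesis
    by (metis mult_left_cancel)
qed

lemma Digamma_sums:
  fixes z :: "'a :: {real_normed_field,banach}"
  assumes "z \<noteq> 0"
  shows "(\<lambda>n. inverse (of_nat (Suc n)) - inverse (z + of_nat n)) sums (Digamma z + euler_mascheroni)"
  using summable_sums[OF summable_Digamma[OF assms]] by (simp add: Digamma_def)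

text \<open>In the difference of the Digamma series at 1 - z and 1 + z the harmonic terms and the
  Euler constant cancel, and the poles at n + 1 and -(n + 1) pair up. Taking 1 + z instead of z
  aligns the indices; the recurrence of Digamma then supplies the term -1/z.\<close>

lemma cot_partial_fractions_sums:
  fixes z :: complex
  assumes "z \<notin> \<int>"
  shows "(\<lambda>n. 2 * z / (z\<^sup>2 - of_nat (Suc n) ^ 2)) sums (of_real pi * cot (of_real pi * z) - 1 / z)"
proof -
  have ne: "z + of_nat n \<noteq> 0" "z - of_nat n \<noteq> 0" for n
    using assms by (metis add_eq_0_iff2 eq_iff_diff_eq_0 Ints_minus Ints_of_nat)+
  have "z \<noteq> 0" "1 + z \<noteq> 0" "1 - z \<noteq> 0" using ne[of 0] ne[of 1] by (auto simp: add.commute)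
  hence "(\<lambda>n. (inverse (of_nat (Suc n)) - inverse ((1 - z) + of_nat n))
      - (inverse (of_nat (Suc n)) - inverse ((1 + z) + of_nat n)))
      sums ((Digamma (1 - z) + euler_mascheroni) - (Digamma (1 + z) + euler_mascheroni))"
    by (intro sums_diff Digamma_sums) auto
  moreover have "(inverse (of_nat (Suc n)) - inverse ((1 - z) + of_nat n))
      - (inverse (of_nat (Suc n)) - inverse ((1 + z) + of_nat n)) = 2 * z / (z\<^sup>2 - of_nat (Suc n) ^ 2)" for n
  proof -
    define a where "a = complex_of_nat (Suc n)"
    have "z + a \<noteq> 0" "a - z \<noteq> 0" using ne[of "Suc n"] by (auto simp: a_def)
    hence "inverse (z + a) - inverse (a - z) = (- 2 * z) / ((z + a) * (a - z))"
      by (simp add: inverse_eq_divide diff_frac_eq)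
    also have "(z + a) * (a - z) = - (z\<^sup>2 - a\<^sup>2)"
      by (simp add: algebra_simps power2_eq_square)
    finally have "inverse (z + a) - inverse (a - z) = 2 * z / (z\<^sup>2 - a\<^sup>2)"
      by (simp only: minus_divide_divide mult_minus_left)
    thus ?thesis by (simp add: a_def algebra_simps)
  qed
  moreover have "Digamma (1 + z) = Digamma z + 1 / z"
    using Digamma_plus1[OF \<open>z \<noteq> 0\<close>] by (simp add: add.commute)
  hence "Digamma (1 - z) + euler_mascheroni - (Digamma (1 + z) + euler_mascheroni) =
      of_real pi * cot (of_real pi * z) - 1 / z"
    using Digamma_reflection[OF assms] by (simp add: algebra_simps)
  ultimately show ?thesis by (simp only:)
qed

text \<open>Unconditional convergence is what the later interchanges of double sums require. Once (n
  + 1)^2 > 2 |z|^2, the denominator is at least (n + 1)^2 / 2, which explains the factor 4 in the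
  majorant.\<close>

lemma cot_partial_fractions_has_sum:
  fixes z :: complex
  assumes "z \<notin> \<int>"
  shows "((\<lambda>n. 2 * z / (z\<^sup>2 - of_nat (Suc n) ^ 2)) has_sum (of_real pi * cot (of_real pi * z) - 1 / z)) UNIV"
proof (rule norm_summable_imp_has_sum[OF _ cot_partial_fractions_sums[OF assms]])
  show "summable (\<lambda>n. norm (2 * z / (z\<^sup>2 - of_nat (Suc n) ^ 2)))"
  proof (rule summable_comparison_test_ev)
    have "eventually (\<lambda>n. real (Suc n) ^ 2 > 2 * norm z ^ 2) at_top"
      by real_asymp
    thus "eventually (\<lambda>n. norm (norm (2 * z / (z\<^sup>2 - of_nat (Suc n) ^ 2))) \<le> 4 * norm z * (1 / real (Suc n) ^ 2)) at_top"
    proof eventually_elim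
      case (elim n)
      have "norm (z\<^sup>2 - of_nat (Suc n) ^ 2) \<ge> real (Suc n) ^ 2 - norm z ^ 2"
        using norm_triangle_ineq2[of "of_nat (Suc n) ^ 2" "z\<^sup>2"]
        by (simp add: norm_power norm_minus_commute del: of_nat_Suc)
      with elim have *: "norm (z\<^sup>2 - of_nat (Suc n) ^ 2) \<ge> real (Suc n) ^ 2 / 2" by linarith
      have "2 * norm z / norm (z\<^sup>2 - of_nat (Suc n) ^ 2) \<le> 2 * norm z / (real (Suc n) ^ 2 / 2)"
        by (intro divide_left_mono * mult_pos_pos) (use * in \<open>auto simp: zero_less_power intro: less_le_trans[of _ "real (Suc n) ^ 2 / 2"] simp del: of_nat_Suc\<close>)
      thus ?case by (simp add: norm_divide norm_mult del: of_nat_Suc)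
    qed
    show "summable (\<lambda>n. 4 * norm z * (1 / real (Suc n) ^ 2))"
      using sums_summable[OF inverse_squares_sums] by (intro summable_mult) (simp add: add.commute)
  qed
qed

section \<open>Even zeta values and Bernoulli numbers\<close>

definition zeta_nat :: "nat \<Rightarrow> complex" where
  "zeta_nat s = (\<Sum>\<^sub>\<infinity>k. 1 / of_nat (Suc k) ^ s)"

lemma summable_on_inverse_power:
  assumes "s \<ge> 2"
  shows "(\<lambda>k. 1 / real (Suc k) ^ s) summable_on UNIV"
proof (rule summable_nonneg_imp_summable_on)
  show "summable (\<lambda>k. 1 / real (Suc k) ^ s)"
    using inverse_power_summable[OF assms, where 'a = real]
    by (subst summable_Suc_iff) (simp add: inverse_eq_divide)
qed auto

lemma zeta_nat_has_sum:
  assumes "s \<ge> 2"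
  shows "((\<lambda>k. 1 / of_nat (Suc k) ^ s) has_sum zeta_nat s) UNIV"
  unfolding zeta_nat_def
  using summable_on_of_real[OF summable_on_inverse_power[OF assms], where 'a = complex]
  by (intro has_sum_infsum) (simp del: of_nat_Suc)

lemma summable_on_product:
  fixes f :: "'a \<Rightarrow> real" and g :: "'b \<Rightarrow> real"
  assumes "f summable_on A" "g summable_on B" "\<And>x. x \<in> A \<Longrightarrow> f x \<ge> 0" "\<And>y. y \<in> B \<Longrightarrow> g y \<ge> 0"
  shows "(\<lambda>(x, y). f x * g y) summable_on A \<times> B"
proof (rule summable_on_SigmaI)
  show "((\<lambda>y. case (x, y) of (x, y) \<Rightarrow> f x * g y) has_sum f x * infsum g B) B" for x
    using has_sum_cmult_right[OF has_sum_infsum[OF assms(2)]] by simp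
  show "(\<lambda>x. f x * infsum g B) summable_on A"
    by (intro summable_on_cmult_left assms)
qed (use assms in auto)

text \<open>Euler's formula, by comparing two power series of z / (e^z - 1) at 0. One is the
  Bernoulli generating function; the other comes from pi w cot(pi w) with z = 2 pi i w, by expanding
  every partial fraction geometrically and collecting the powers of w.\<close>

lemma zeta_nat_bernoulli:
  assumes "k \<ge> 1"
  shows "zeta_nat (2 * k) = (-1) ^ Suc k / 2 * (2 * of_real pi) ^ (2 * k) * of_real (bernoulli (2 * k)) / fact (2 * k)"
proof -
  \<comment> \<open>The coefficients that the cotangent expansion predicts. Those at 0 and 1 come
    from z / (e^z - 1) = (z / 2) (e^z + 1) / (e^z - 1) - z / 2.\<close>
  define c where "c = (\<lambda>n. if n = 0 then 1 else if n = 1 then -1/2 else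
    if even n then - 2 * (-1) ^ (n div 2) * zeta_nat n / (2 * of_real pi) ^ n else 0 :: complex)"
  define d where "d = (\<lambda>n. of_real (bernoulli n) / fact n :: complex)"
  have d_sums: "(\<lambda>n. d n * z ^ n) sums (if z = 0 then 1 else z / (exp z - 1))" if "norm z < 1" for z
    using bernoulli_sums_complex[of z] that pi_gt3 by (simp add: d_def)
  \<comment> \<open>Agreement near 0 determines the coefficients; the radius 1 is convenient because
    it also forces |w| < 1.\<close>
  have c_sums: "(\<lambda>n. c n * z ^ n) sums (if z = 0 then 1 else z / (exp z - 1))" if z: "norm z < 1" for z
  proof (cases "z = 0")
    case True
    thus ?thesis by (simp add: c_def)
  next
    case False
    define w where "w = z / (2 * of_real pi * \<i>)"
    have w0: "w \<noteq> 0" and zw: "z = 2 * of_real pi * \<i> * w" using False by (auto simp: w_def)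
    have w1: "norm w < 1"
      using z pi_gt3 by (simp add: w_def norm_divide norm_mult divide_simps)
    have wZ: "w \<notin> \<int>"
      using w1 w0 by (auto simp: Ints_def)
    \<comment> \<open>Term \<open>k\<close> of the geometric expansion of 2 w^2 / (w^2 - (j + 1)^2).
      Summing over \<open>k\<close> gives back the partial fraction, summing over \<open>j\<close>
      gives an even zeta value.\<close>
    define f where "f = (\<lambda>j k. - 2 * w ^ (2 * Suc k) / of_nat (Suc j) ^ (2 * Suc k))"
    have f1: "((\<lambda>k. f j k) has_sum (2 * w\<^sup>2 / (w\<^sup>2 - of_nat (Suc j) ^ 2))) UNIV" for j
      proof -
      define q where "q = w\<^sup>2 / of_nat (Suc j) ^ 2"
      have "norm q = (norm w / real (Suc j)) ^ 2"
        by (simp add: q_def norm_divide norm_power power_divide del: of_nat_Suc)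
      also have "\<dots> < 1"
        unfolding abs_square_less_1 using w1 by (simp add: divide_simps)
      finally have q: "norm q < 1" .
      have "((\<lambda>k. - 2 * q * q ^ k) has_sum (- 2 * q * (1 / (1 - q)))) UNIV"
        using q by (intro has_sum_cmult_right norm_summable_imp_has_sum geometric_sums)
          (auto simp: norm_power)
      moreover have "- 2 * q * q ^ k = f j k" for k
      proof -
        have "f j k = - 2 * q ^ Suc k"
          by (simp only: f_def q_def power_mult power_divide times_divide_eq_right)
        thus ?thesis by simp
      qed
      moreover have "- 2 * q * (1 / (1 - q)) = 2 * w\<^sup>2 / (w\<^sup>2 - of_nat (Suc j) ^ 2)"
      proof -
        define a where "a = complex_of_nat (Suc j) ^ 2"
        have a: "a \<noteq> 0" "1 - q = (a - w\<^sup>2) / a"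
          by (simp_all add: a_def q_def diff_divide_distrib del: of_nat_Suc)
        have "- 2 * q * (1 / (1 - q)) = - (2 * w\<^sup>2) / (a - w\<^sup>2)"
          unfolding a(2) using a(1) by (simp add: q_def a_def del: of_nat_Suc)
        also have "\<dots> = 2 * w\<^sup>2 / (w\<^sup>2 - a)"
          by (metis minus_diff_eq minus_divide_divide)
        finally show ?thesis by (simp only: a_def)
      qed
      ultimately show ?thesis by simp
    qed
    have f2: "((\<lambda>j. f j k) has_sum (- 2 * w ^ (2 * Suc k) * zeta_nat (2 * Suc k))) UNIV" for k
      using has_sum_cmult_right[OF zeta_nat_has_sum[of "2 * Suc k"], of "- 2 * w ^ (2 * Suc k)"]
      by (simp add: f_def del: of_nat_Suc)
    have f3: "(\<lambda>(j, k). f j k) summable_on UNIV \<times> UNIV"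
      proof (rule abs_summable_summable, rule Infinite_Sum.abs_summable_on_comparison_test')
      \<comment> \<open>The majorant separates the variables: two powers of j + 1 are kept for
        convergence in \<open>j\<close>, and |w|^k for convergence in \<open>k\<close>.\<close>
      show "(\<lambda>(j, k). 1 / real (Suc j) ^ 2 * (2 * norm w ^ k)) summable_on UNIV \<times> UNIV"
        using w1 by (intro summable_on_product summable_on_inverse_power
            summable_on_cmult_right summable_nonneg_imp_summable_on) auto
      fix x :: "nat \<times> nat"
      obtain j k where x: "x = (j, k)" by (cases x)
      have "norm (f j k) = 1 / real (Suc j) ^ (2 * Suc k) * (2 * norm w ^ (2 * Suc k))"
        by (simp add: f_def norm_divide norm_mult norm_power del: of_nat_Suc power_Suc)
      also have "\<dots> \<le> 1 / real (Suc j) ^ 2 * (2 * norm w ^ k)"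
        using w1 by (intro mult_mono divide_left_mono power_decreasing power_increasing) auto
      finally show "norm (case x of (j, k) \<Rightarrow> f j k) \<le> (case x of (j, k) \<Rightarrow> 1 / real (Suc j) ^ 2 * (2 * norm w ^ k))"
        by (simp add: x)
    qed
    have "((\<lambda>j. w * (2 * w / (w\<^sup>2 - of_nat (Suc j) ^ 2))) has_sum (w * (of_real pi * cot (of_real pi * w) - 1 / w))) UNIV"
      by (intro has_sum_cmult_right cot_partial_fractions_has_sum wZ)
    hence "((\<lambda>j. 2 * w\<^sup>2 / (w\<^sup>2 - of_nat (Suc j) ^ 2)) has_sum (of_real pi * w * cot (of_real pi * w) - 1)) UNIV"
      using w0 by (simp add: algebra_simps power2_eq_square del: of_nat_Suc)
    from has_sum_SigmaI[of UNIV "\<lambda>(j, k). f j k", OF _ this f3] f1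
    have "((\<lambda>(j, k). f j k) has_sum (of_real pi * w * cot (of_real pi * w) - 1)) (UNIV \<times> UNIV)"
      by simp
    hence "((\<lambda>(k, j). f j k) has_sum (of_real pi * w * cot (of_real pi * w) - 1)) (UNIV \<times> UNIV)"
      by (subst (asm) has_sum_swap) simp
    hence "((\<lambda>k. - 2 * w ^ (2 * Suc k) * zeta_nat (2 * Suc k)) has_sum (of_real pi * w * cot (of_real pi * w) - 1)) UNIV"
    proof (rule has_sum_SigmaD)
      show "((\<lambda>j. case (k, j) of (k, j) \<Rightarrow> f j k) has_sum (- 2 * w ^ (2 * Suc k) * zeta_nat (2 * Suc k))) UNIV" for k
        using f2[of k] by (simp only: prod.case)
    qed
    hence "(\<lambda>k. - 2 * w ^ (2 * Suc k) * zeta_nat (2 * Suc k)) sums (of_real pi * w * cot (of_real pi * w) - 1)"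
      by (rule has_sum_imp_sums)
    also have "(\<lambda>k. - 2 * w ^ (2 * Suc k) * zeta_nat (2 * Suc k)) = (\<lambda>k. c (2 * Suc k) * z ^ (2 * Suc k))"
    proof
      fix k
      let ?n = "2 * Suc k"
      define P s where "P = (2 * complex_of_real pi) ^ ?n" and "s = (-1 :: complex) ^ Suc k"
      have n: "?n \<noteq> 0" "?n \<noteq> 1" "even ?n" "?n div 2 = Suc k" by auto
      have "c ?n = - 2 * s * zeta_nat ?n / P"
        by (simp only: c_def n if_False if_True P_def s_def)
      moreover have "z ^ ?n = P * s * w ^ ?n"
        unfolding zw power_mult_distrib P_def s_def power_mult [of \<i>] by (simp only: power2_i)
      moreover have "P \<noteq> 0"
        by (simp add: P_def)
      moreover have "s * s = 1"
        by (simp only: s_def power_mult_distrib [symmetric]) simp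
      ultimately show "- 2 * w ^ ?n * zeta_nat ?n = c ?n * z ^ ?n"
        by (simp add: mult_ac del: power_Suc mult_Suc_right)
    qed
    finally have "(\<lambda>k. c (2 * Suc k) * z ^ (2 * Suc k)) sums (of_real pi * w * cot (of_real pi * w) - 1)" .
    \<comment> \<open>Reindexing along the even n >= 2 loses nothing, as \<open>c\<close> vanishes
      at odd indices above 1.\<close>
    hence "(\<lambda>n. if n \<le> 1 then 0 else c n * z ^ n) sums (of_real pi * w * cot (of_real pi * w) - 1)"
    proof (subst sums_mono_reindex [where g = "\<lambda>k. 2 * Suc k", symmetric])
      show "(if n \<le> 1 then 0 else c n * z ^ n) = 0" if "n \<notin> range (\<lambda>k. 2 * Suc k)" for n
      proof (cases "even n \<and> n \<ge> 2")
        case True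
        hence "n = 2 * Suc (n div 2 - 1)" by auto
        with that show ?thesis by blast
      qed (auto simp: c_def)
    qed (auto simp: strict_mono_def)
    moreover have "(\<lambda>n. if n \<le> 1 then c n * z ^ n else 0) sums (\<Sum>n\<le>1. c n * z ^ n)"
      using sums_If_finite_set[of "{..1}" "\<lambda>n. c n * z ^ n"] by simp
    ultimately have "(\<lambda>n. (if n \<le> 1 then 0 else c n * z ^ n) + (if n \<le> 1 then c n * z ^ n else 0))
      sums (of_real pi * w * cot (of_real pi * w) - 1 + (\<Sum>n\<le>1. c n * z ^ n))"
      by (rule sums_add)
    moreover have "of_real pi * w * cot (of_real pi * w) - 1 + (\<Sum>n\<le>1. c n * z ^ n) = z / (exp z - 1)"
    proof -
      have "exp z \<noteq> 1"
        using exp_eq_1_imp_zero[of z] False z pi_gt3 by auto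
      moreover have "of_real pi * w * cot (of_real pi * w) = z / 2 * (exp z + 1) / (exp z - 1)"
        unfolding cot_conv_exp by (simp add: zw mult_ac)
      moreover have "(\<Sum>n\<le>1. c n * z ^ n) = 1 - z / 2"
        by (simp add: c_def)
      moreover have "z / 2 * (E + 1) / (E - 1) = z / 2 + z / (E - 1)" if "E \<noteq> 1" for E
        using that by (simp add: divide_simps) (simp add: algebra_simps)
      ultimately show ?thesis
        by simp
    qed
    moreover have "(\<lambda>n. (if n \<le> 1 then 0 else c n * z ^ n) + (if n \<le> 1 then c n * z ^ n else 0)) = (\<lambda>n. c n * z ^ n)"
      by auto
    ultimately show ?thesis using False by (simp only: if_False)
  qed
  have "c = d"
  proof -
    have ev: "eventually (\<lambda>z::complex. norm z < 1) (nhds 0)"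
      using eventually_nhds_in_open[of "ball (0::complex) 1" 0] by simp
    let ?f = "\<lambda>z::complex. if z = 0 then 1 else z / (exp z - 1)"
    have "?f has_fps_expansion Abs_fps c" "?f has_fps_expansion Abs_fps d"
      by (rule has_fps_expansionI, rule eventually_mono[OF ev], use c_sums d_sums in simp)+
    hence "Abs_fps c = Abs_fps d" by (rule fps_expansion_unique_complex)
    thus ?thesis by (simp add: Abs_fps_inject)
  qed
  hence d: "of_real (bernoulli (2 * k)) / fact (2 * k) = - 2 * (-1) ^ k * zeta_nat (2 * k) / (2 * of_real pi) ^ (2 * k)"
    using assms by (auto simp: c_def d_def dest: fun_cong[of _ _ "2 * k"])
  have "(-1 :: complex) ^ k * (-1) ^ k = 1"
    by (simp only: power_mult_distrib [symmetric]) simp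
  thus ?thesis
    by (simp only: times_divide_eq_right [symmetric] d) simp
qed

section \<open>Double sums and the reciprocity of the cotangent series\<close>

lemma has_sum_sum:
  fixes f :: "'i \<Rightarrow> 'a \<Rightarrow> 'b :: topological_comm_monoid_add"
  assumes "finite I" "\<And>i. i \<in> I \<Longrightarrow> (f i has_sum S i) A"
  shows "((\<lambda>x. \<Sum>i\<in>I. f i x) has_sum (\<Sum>i\<in>I. S i)) A"
  using assms by (induction I rule: finite_induct) (auto intro: has_sum_add)

lemma has_sum_product:
  fixes f :: "'a \<Rightarrow> 'c :: {real_normed_field, banach}" and g :: "'b \<Rightarrow> 'c"
  assumes f: "(f has_sum s) A" "(\<lambda>x. norm (f x)) summable_on A"
    and g: "(g has_sum t) B" "(\<lambda>y. norm (g y)) summable_on B"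
  shows "((\<lambda>(x, y). f x * g y) has_sum s * t) (A \<times> B)"
proof (rule has_sum_SigmaI)
  show "((\<lambda>y. case (x, y) of (x, y) \<Rightarrow> f x * g y) has_sum f x * t) B" for x
    using has_sum_cmult_right[OF g(1)] by simp
  show "((\<lambda>x. f x * t) has_sum s * t) A"
    by (intro has_sum_cmult_left f)
  have "(\<lambda>p. norm (case p of (x, y) \<Rightarrow> f x * g y)) summable_on A \<times> B"
    using summable_on_product[OF f(2) g(2)] by (simp add: norm_mult case_prod_unfold)
  thus "(\<lambda>(x, y). f x * g y) summable_on A \<times> B"
    by (rule abs_summable_summable)
qed

lemma zeta_nat_product_has_sum:
  assumes "a \<ge> 2" "b \<ge> 2"
  shows "((\<lambda>(k, j). 1 / (of_nat (Suc k) ^ a * of_nat (Suc j) ^ b)) has_sum zeta_nat a * zeta_nat b) (UNIV \<times> UNIV)"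
proof -
  have *: "(\<lambda>k. norm (1 / of_nat (Suc k) ^ s :: complex)) summable_on UNIV" if "s \<ge> 2" for s
    using summable_on_inverse_power[OF that] by (simp add: norm_divide norm_power del: of_nat_Suc)
  show ?thesis
    using has_sum_product[OF zeta_nat_has_sum[OF assms(1)] *[OF assms(1)] zeta_nat_has_sum[OF assms(2)] *[OF assms(2)]]
    by (simp add: case_prod_unfold)
qed

text \<open>Iterates 1 / (x (x t - y)) = (t / (x t - y) - 1 / x) / y, each step trading a factor x
  for y / t. With x = k^2, y = j^2, t = \<tau>^2 the first term on the right is, up to sign and a
  power of \<tau>, the kernel at -1/\<tau> with k and j exchanged, and the remaining terms factor
  into a power of k times a power of j.\<close>

lemma partial_fraction_telescope:
  fixes x y t :: "'a :: field"
  assumes "x \<noteq> 0" "y \<noteq> 0" "x * t \<noteq> y"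
  shows "t / (x ^ N * (x * t - y)) =
    t ^ Suc N / (y ^ N * (x * t - y)) - (\<Sum>i<N. t ^ (N - i) / (x ^ Suc i * y ^ (N - i)))"
proof (induction N)
  case 0
  show ?case by simp
next
  case (Suc N)
  define d where "d = x * t - y"
  have d: "d \<noteq> 0" using assms by (simp add: d_def)
  have "(\<Sum>i<Suc N. t ^ (Suc N - i) / (x ^ Suc i * y ^ (Suc N - i))) =
      t / (x ^ Suc N * y) + (\<Sum>i<N. t / y * (t ^ (N - i) / (x ^ Suc i * y ^ (N - i))))"
  proof -
    have "t ^ (Suc N - i) / (x ^ Suc i * y ^ (Suc N - i)) = t / y * (t ^ (N - i) / (x ^ Suc i * y ^ (N - i)))"
      if "i < N" for i
      using that by (simp add: Suc_diff_le less_imp_le mult_ac)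
    thus ?thesis by simp
  qed
  also have "\<dots> = t / (x ^ Suc N * y) + t / y * (t ^ Suc N / (y ^ N * d) - t / (x ^ N * d))"
    unfolding sum_distrib_left [symmetric] using Suc.IH by (simp add: d_def)
  also have "\<dots> = t ^ Suc (Suc N) / (y ^ Suc N * d) - t / (x ^ Suc N * d)"
  proof -
    have "t / (x ^ Suc N * y) - t / y * (t / (x ^ N * d)) = - (t / (x ^ Suc N * d))"
    proof -
      have "t / (x ^ Suc N * y) = t * d / (x ^ Suc N * y * d)"
        using d by simp
      moreover have "t / y * (t / (x ^ N * d)) = t * (x * t) / (x ^ Suc N * y * d)"
        using assms by simp
      moreover have "- (t / (x ^ Suc N * d)) = - (t * y) / (x ^ Suc N * y * d)"
        using assms by simp
      moreover have "t * d - t * (x * t) = - (t * y)"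
        by (simp add: d_def algebra_simps)
      ultimately show ?thesis
        by (metis diff_divide_distrib)
    qed
    moreover have "t / y * (t ^ Suc N / (y ^ N * d)) = t ^ Suc (Suc N) / (y ^ Suc N * d)"
      by simp
    ultimately show ?thesis
      by (simp only: right_diff_distrib) (simp add: algebra_simps)
  qed
  finally show ?case
    by (simp add: d_def)
qed

definition cot_kernel_sum :: "nat \<Rightarrow> complex \<Rightarrow> complex" where
  "cot_kernel_sum N \<tau> = (\<Sum>\<^sub>\<infinity>(k, j). 1 / (of_nat (Suc k) ^ (2 * N) * (of_nat (Suc k) ^ 2 * \<tau>\<^sup>2 - of_nat (Suc j) ^ 2)))"

definition cot_series :: "nat \<Rightarrow> complex \<Rightarrow> complex" where
  "cot_series N \<tau> = (\<Sum>\<^sub>\<infinity>k. cot (of_real pi * (of_nat (Suc k) * \<tau>)) / of_nat (Suc k) ^ (2 * N + 1))"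

text \<open>The real part is already at most -j^2. The bound does not depend on \<open>k\<close>, so
  the kernel sum is dominated by zeta(2N) zeta(2).\<close>

lemma norm_kernel_ge:
  fixes \<tau> :: complex
  assumes "Re (\<tau>\<^sup>2) \<le> 0"
  shows "norm (of_nat k ^ 2 * \<tau>\<^sup>2 - of_nat j ^ 2) \<ge> real j ^ 2"
proof -
  have "Re (of_nat k ^ 2 * \<tau>\<^sup>2 - of_nat j ^ 2) = real k ^ 2 * Re (\<tau>\<^sup>2) - real j ^ 2"
    by (simp flip: of_nat_power)
  also have "\<dots> \<le> - (real j ^ 2)"
    using assms by (simp add: mult_nonneg_nonpos)
  finally show ?thesis
    using abs_Re_le_cmod[of "of_nat k ^ 2 * \<tau>\<^sup>2 - of_nat j ^ 2"] by linarith
qed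

lemma cot_kernel_has_sum:
  fixes \<tau> :: complex
  assumes "Re (\<tau>\<^sup>2) \<le> 0" "N \<ge> 1"
  shows "((\<lambda>(k, j). 1 / (of_nat (Suc k) ^ (2 * N) * (of_nat (Suc k) ^ 2 * \<tau>\<^sup>2 - of_nat (Suc j) ^ 2)))
    has_sum cot_kernel_sum N \<tau>) (UNIV \<times> UNIV)"
  unfolding cot_kernel_sum_def UNIV_Times_UNIV
proof (rule has_sum_infsum, rule abs_summable_summable, rule Infinite_Sum.abs_summable_on_comparison_test')
  show "(\<lambda>(k, j). 1 / real (Suc k) ^ (2 * N) * (1 / real (Suc j) ^ 2)) summable_on UNIV"
    unfolding UNIV_Times_UNIV [symmetric]
    using assms by (intro summable_on_product summable_on_inverse_power) auto
  fix x :: "nat \<times> nat"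
  obtain k j where x: "x = (k, j)" by (cases x)
  let ?d = "complex_of_nat (Suc k) ^ 2 * \<tau>\<^sup>2 - of_nat (Suc j) ^ 2"
  have "1 / norm ?d \<le> 1 / real (Suc j) ^ 2"
    by (intro divide_left_mono norm_kernel_ge assms mult_pos_pos)
       (use norm_kernel_ge[OF assms(1), of "Suc j" "Suc k"] in \<open>auto intro: less_le_trans[of 0 "real (Suc j) ^ 2"] simp del: of_nat_Suc\<close>)
  hence "1 / real (Suc k) ^ (2 * N) * (1 / norm ?d) \<le> 1 / real (Suc k) ^ (2 * N) * (1 / real (Suc j) ^ 2)"
    by (rule mult_left_mono) auto
  thus "norm (case x of (k, j) \<Rightarrow> 1 / (of_nat (Suc k) ^ (2 * N) * (of_nat (Suc k) ^ 2 * \<tau>\<^sup>2 - of_nat (Suc j) ^ 2)))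
      \<le> (case x of (k, j) \<Rightarrow> 1 / real (Suc k) ^ (2 * N) * (1 / real (Suc j) ^ 2))"
    by (simp add: x norm_divide norm_mult norm_power del: of_nat_Suc)
qed

text \<open>Summing the kernel over j first is the partial fraction expansion at z = k \<tau>; its
  isolated term 1 / (k \<tau>) produces zeta(2N + 2) / \<tau>.\<close>

lemma cot_series_has_sum:
  fixes \<tau> :: complex
  assumes \<tau>: "\<tau> \<noteq> 0" "Re (\<tau>\<^sup>2) \<le> 0" and N: "N \<ge> 1"
  shows "((\<lambda>k. cot (of_real pi * (of_nat (Suc k) * \<tau>)) / of_nat (Suc k) ^ (2 * N + 1)) has_sum
    (zeta_nat (2 * N + 2) / \<tau> + 2 * \<tau> * cot_kernel_sum N \<tau>) / of_real pi) UNIV"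
proof -
  let ?K = "\<lambda>k. complex_of_nat (Suc k)"
  \<comment> \<open>An integer value n would be nonzero, so k^2 \<tau>^2 = n^2 would be positive,
    against Re \<tau>^2 <= 0.\<close>
  have notin: "?K k * \<tau> \<notin> \<int>" for k
  proof
    assume "?K k * \<tau> \<in> \<int>"
    then obtain n where n: "?K k * \<tau> = of_int n" by (elim Ints_cases)
    have "n \<noteq> 0" using n \<tau> by (auto simp del: of_nat_Suc)
    have "(?K k)\<^sup>2 * \<tau>\<^sup>2 = of_int (n\<^sup>2)"
      using n by (metis of_int_power power_mult_distrib)
    hence "Re ((?K k)\<^sup>2 * \<tau>\<^sup>2) = of_int (n\<^sup>2)"
      by simp
    hence "real (Suc k) ^ 2 * Re (\<tau>\<^sup>2) = of_int (n\<^sup>2)"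
      by (simp flip: of_nat_power del: of_nat_Suc)
    moreover have "real (Suc k) ^ 2 * Re (\<tau>\<^sup>2) \<le> 0"
      using \<tau> by (intro mult_nonneg_nonpos) auto
    moreover have "0 < real_of_int (n\<^sup>2)"
      using \<open>n \<noteq> 0\<close> by simp
    ultimately show False by linarith
  qed
  have inner: "((\<lambda>j. 1 / (?K k ^ (2 * N) * (?K k ^ 2 * \<tau>\<^sup>2 - ?K j ^ 2))) has_sum
      (of_real pi * cot (of_real pi * (?K k * \<tau>)) - 1 / (?K k * \<tau>)) / (2 * \<tau> * ?K k ^ (2 * N + 1))) UNIV" for k
  proof -
    have "((\<lambda>j. (2 * (?K k * \<tau>) / ((?K k * \<tau>)\<^sup>2 - ?K j ^ 2)) / (2 * \<tau> * ?K k ^ (2 * N + 1))) has_sum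
      (of_real pi * cot (of_real pi * (?K k * \<tau>)) - 1 / (?K k * \<tau>)) / (2 * \<tau> * ?K k ^ (2 * N + 1))) UNIV"
      by (intro has_sum_divide_const cot_partial_fractions_has_sum notin)
    moreover have "(2 * (?K k * \<tau>) / ((?K k * \<tau>)\<^sup>2 - ?K j ^ 2)) / (2 * \<tau> * ?K k ^ (2 * N + 1)) =
        1 / (?K k ^ (2 * N) * (?K k ^ 2 * \<tau>\<^sup>2 - ?K j ^ 2))" for j
    proof -
      have "?K k \<noteq> 0" by (simp del: of_nat_Suc)
      thus ?thesis using \<tau> by (simp add: power_mult_distrib del: of_nat_Suc)
    qed
    ultimately show ?thesis by (simp only:)
  qed
  have "((\<lambda>k. (of_real pi * cot (of_real pi * (?K k * \<tau>)) - 1 / (?K k * \<tau>)) / (2 * \<tau> * ?K k ^ (2 * N + 1))) has_sum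
      cot_kernel_sum N \<tau>) UNIV"
    using cot_kernel_has_sum[OF \<tau>(2) N] by (rule has_sum_SigmaD) (use inner in simp)
  from has_sum_divide_const[OF has_sum_add[OF has_sum_divide_const[OF zeta_nat_has_sum[of "2 * N + 2"], of \<tau>]
    has_sum_cmult_right[OF this, of "2 * \<tau>"]], of "of_real pi"]
  have "((\<lambda>k. (1 / ?K k ^ (2 * N + 2) / \<tau> +
      2 * \<tau> * ((of_real pi * cot (of_real pi * (?K k * \<tau>)) - 1 / (?K k * \<tau>)) / (2 * \<tau> * ?K k ^ (2 * N + 1)))) / of_real pi) has_sum
      (zeta_nat (2 * N + 2) / \<tau> + 2 * \<tau> * cot_kernel_sum N \<tau>) / of_real pi) UNIV"
    by (simp only: le_add2)
  moreover have "(1 / ?K k ^ (2 * N + 2) / \<tau> +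
      2 * \<tau> * ((of_real pi * cot (of_real pi * (?K k * \<tau>)) - 1 / (?K k * \<tau>)) / (2 * \<tau> * ?K k ^ (2 * N + 1)))) / of_real pi =
      cot (of_real pi * (?K k * \<tau>)) / ?K k ^ (2 * N + 1)" for k
  proof -
    define a where "a = ?K k"
    define P where "P = a ^ (2 * N + 1)"
    have "a \<noteq> 0" by (simp add: a_def del: of_nat_Suc)
    hence "P \<noteq> 0" "a ^ (2 * N + 2) = a * P" by (simp_all add: P_def)
    have "2 * \<tau> * ((of_real pi * c - 1 / (a * \<tau>)) / (2 * \<tau> * P)) = of_real pi * c / P - 1 / (a * P) / \<tau>" for c
    proof -
      have "2 * \<tau> * (u / (2 * \<tau> * P)) = u / P" for u
        using \<tau>(1) by simp
      thus ?thesis by (simp only:) (simp add: diff_divide_distrib mult_ac)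
    qed
    thus ?thesis
      unfolding a_def [symmetric] P_def [symmetric] \<open>a ^ (2 * N + 2) = a * P\<close> by simp
  qed
  ultimately show ?thesis by (simp only:)
qed

text \<open>\<open>partial_fraction_telescope\<close> holds term by term, and each piece converges
  absolutely over pairs, so the pieces may be summed separately and the order of k and j swapped in
  the first one.\<close>

lemma cot_kernel_sum_reciprocity:
  fixes \<tau> :: complex
  assumes \<tau>: "\<tau> \<noteq> 0" "Re (\<tau>\<^sup>2) \<le> 0" and N: "N \<ge> 1"
  shows "\<tau>\<^sup>2 * cot_kernel_sum N \<tau> = - (\<tau> ^ (2 * N) * cot_kernel_sum N (- 1 / \<tau>))
    - (\<Sum>i<N. (\<tau>\<^sup>2) ^ (N - i) * (zeta_nat (2 * Suc i) * zeta_nat (2 * (N - i))))"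
proof -
  let ?K = "\<lambda>k. complex_of_nat (Suc k)"
  have \<sigma>: "(- 1 / \<tau>)\<^sup>2 = 1 / \<tau>\<^sup>2" by (simp add: power_divide)
  have Re\<sigma>: "Re ((- 1 / \<tau>)\<^sup>2) \<le> 0"
    unfolding \<sigma> using \<tau>(2) by (simp add: Re_divide divide_nonpos_nonneg)
  have "((\<lambda>(k, j). \<tau>\<^sup>2 * (1 / (?K k ^ (2 * N) * (?K k ^ 2 * \<tau>\<^sup>2 - ?K j ^ 2)))) has_sum \<tau>\<^sup>2 * cot_kernel_sum N \<tau>) (UNIV \<times> UNIV)"
    using has_sum_cmult_right[OF cot_kernel_has_sum[OF \<tau>(2) N], of "\<tau>\<^sup>2"] by (simp add: case_prod_unfold)
  moreover have "((\<lambda>(k, j). - (\<tau> ^ (2 * N) * (1 / (?K j ^ (2 * N) * (?K j ^ 2 * (- 1 / \<tau>)\<^sup>2 - ?K k ^ 2))))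
      - (\<Sum>i<N. (\<tau>\<^sup>2) ^ (N - i) * (1 / (?K k ^ (2 * Suc i) * ?K j ^ (2 * (N - i)))))) has_sum
      (- (\<tau> ^ (2 * N) * cot_kernel_sum N (- 1 / \<tau>))
        - (\<Sum>i<N. (\<tau>\<^sup>2) ^ (N - i) * (zeta_nat (2 * Suc i) * zeta_nat (2 * (N - i)))))) (UNIV \<times> UNIV)"
  proof -
    have "((\<lambda>(k, j). 1 / (?K j ^ (2 * N) * (?K j ^ 2 * (- 1 / \<tau>)\<^sup>2 - ?K k ^ 2))) has_sum cot_kernel_sum N (- 1 / \<tau>)) (UNIV \<times> UNIV)"
      using cot_kernel_has_sum[OF Re\<sigma> N] by (subst has_sum_swap) simp
    hence 1: "((\<lambda>p. 1 / (?K (snd p) ^ (2 * N) * (?K (snd p) ^ 2 * (- 1 / \<tau>)\<^sup>2 - ?K (fst p) ^ 2))) has_sum cot_kernel_sum N (- 1 / \<tau>)) (UNIV \<times> UNIV)"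
      by (simp only: case_prod_unfold)
    have 2: "((\<lambda>p. 1 / (?K (fst p) ^ (2 * Suc i) * ?K (snd p) ^ (2 * (N - i)))) has_sum
        zeta_nat (2 * Suc i) * zeta_nat (2 * (N - i))) (UNIV \<times> UNIV)" if "i < N" for i
      using zeta_nat_product_has_sum[of "2 * Suc i" "2 * (N - i)"] that by (simp add: case_prod_unfold del: of_nat_Suc mult_Suc_right)
    have 3: "((\<lambda>p. \<Sum>i<N. (\<tau>\<^sup>2) ^ (N - i) * (1 / (?K (fst p) ^ (2 * Suc i) * ?K (snd p) ^ (2 * (N - i))))) has_sum
        (\<Sum>i<N. (\<tau>\<^sup>2) ^ (N - i) * (zeta_nat (2 * Suc i) * zeta_nat (2 * (N - i))))) (UNIV \<times> UNIV)"
      by (intro has_sum_sum has_sum_cmult_right 2) auto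
    show ?thesis
      using has_sum_add[OF has_sum_uminusI[OF has_sum_cmult_right[OF 1, of "\<tau> ^ (2 * N)"]] has_sum_uminusI[OF 3]]
      by (simp only: case_prod_unfold diff_conv_add_uminus)
  qed
  moreover have "\<tau>\<^sup>2 * (1 / (?K k ^ (2 * N) * (?K k ^ 2 * \<tau>\<^sup>2 - ?K j ^ 2))) =
      - (\<tau> ^ (2 * N) * (1 / (?K j ^ (2 * N) * (?K j ^ 2 * (- 1 / \<tau>)\<^sup>2 - ?K k ^ 2))))
      - (\<Sum>i<N. (\<tau>\<^sup>2) ^ (N - i) * (1 / (?K k ^ (2 * Suc i) * ?K j ^ (2 * (N - i)))))" for k j
  proof -
    define x y t where "x = ?K k ^ 2" and "y = ?K j ^ 2" and "t = \<tau>\<^sup>2"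
    have nz: "x \<noteq> 0" "y \<noteq> 0" "t \<noteq> 0"
      using \<tau> by (simp_all add: x_def y_def t_def del: of_nat_Suc)
    have "x * t - y \<noteq> 0"
      using norm_kernel_ge[OF \<tau>(2), of "Suc j" "Suc k"] unfolding x_def y_def t_def
      by (metis norm_zero not_less of_nat_0_less_iff zero_less_Suc zero_less_power)
    hence ne: "x * t \<noteq> y" by simp
    \<comment> \<open>Rewrites the denominator of the kernel at -1/\<tau> in terms of x t - y; the
      minus sign is the one in front of the reflected kernel sum.\<close>
    have "y / t - x = - ((x * t - y) / t)"
      using nz by (simp add: diff_divide_distrib)
    hence "- (t ^ N * (1 / (y ^ N * (y / t - x)))) = t ^ Suc N / (y ^ N * (x * t - y))"
      by simp
    with partial_fraction_telescope[OF nz(1,2) ne, of N] show ?thesis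
      unfolding power_mult \<sigma> x_def [symmetric] y_def [symmetric] t_def [symmetric] by simp
  qed
  ultimately show ?thesis
    by (simp only: has_sum_unique)
qed

text \<open>For \<tau> on the imaginary axis this is Ramanujan's formula for zeta(2N + 1) in
  cotangent form.\<close>

theorem cot_series_reciprocity:
  fixes \<tau> :: complex
  assumes \<tau>: "\<tau> \<noteq> 0" "Re (\<tau>\<^sup>2) \<le> 0" and N: "N \<ge> 1"
  shows "\<tau> * (cot_series N \<tau> - \<tau> ^ (2 * N) * cot_series N (- 1 / \<tau>)) =
    (-1) ^ N * (2 * of_real pi) ^ (2 * N + 1) *
    (\<Sum>j\<le>N+1. (\<tau>\<^sup>2) ^ j * of_real (bernoulli (2 * j) / fact (2 * j) * (bernoulli (2 * (N + 1 - j)) / fact (2 * (N + 1 - j)))))"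
proof -
  define \<beta> where "\<beta> = (\<lambda>j. complex_of_real (bernoulli (2 * j) / fact (2 * j)))"
  define t where "t = \<tau>\<^sup>2"
  define p where "p = 2 * complex_of_real pi"
  define Z where "Z = (\<lambda>k. zeta_nat (2 * k))"
  have tN: "\<tau> ^ (2 * N) = t ^ N" by (simp only: t_def power_mult)
  have \<sigma>: "(- 1 / \<tau>)\<^sup>2 = 1 / \<tau>\<^sup>2" by (simp add: power_divide)
  have Re\<sigma>: "Re ((- 1 / \<tau>)\<^sup>2) \<le> 0"
    unfolding \<sigma> using \<tau>(2) by (simp add: Re_divide divide_nonpos_nonneg)
  have C1: "of_real pi * cot_series N \<tau> = Z (Suc N) / \<tau> + 2 * \<tau> * cot_kernel_sum N \<tau>"
    using infsumI[OF cot_series_has_sum[OF \<tau> N]] by (simp add: cot_series_def Z_def)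
  have C2: "of_real pi * cot_series N (- 1 / \<tau>) = - (\<tau> * Z (Suc N)) - 2 / \<tau> * cot_kernel_sum N (- 1 / \<tau>)"
    using infsumI[OF cot_series_has_sum[OF _ Re\<sigma> N]] \<tau> by (simp add: cot_series_def Z_def)
  have Z: "Z k = (-1) ^ Suc k / 2 * p ^ (2 * k) * \<beta> k" if "k \<ge> 1" for k
    using zeta_nat_bernoulli[OF that] by (simp add: \<beta>_def p_def Z_def)
  have "of_real pi * (\<tau> * (cot_series N \<tau> - \<tau> ^ (2 * N) * cot_series N (- 1 / \<tau>))) =
      \<tau> * (of_real pi * cot_series N \<tau>) - \<tau> * t ^ N * (of_real pi * cot_series N (- 1 / \<tau>))"
    unfolding tN by (simp add: algebra_simps)
  also have "\<dots> = Z (Suc N) + t ^ Suc N * Z (Suc N) + 2 * (t * cot_kernel_sum N \<tau> + t ^ N * cot_kernel_sum N (- 1 / \<tau>))"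
    unfolding C1 C2 using \<tau> by (simp add: t_def algebra_simps power2_eq_square)
  also have "t * cot_kernel_sum N \<tau> + t ^ N * cot_kernel_sum N (- 1 / \<tau>) = - (\<Sum>i<N. t ^ (N - i) * (Z (Suc i) * Z (N - i)))"
    using cot_kernel_sum_reciprocity[OF \<tau> N] unfolding tN by (simp add: t_def Z_def)
  \<comment> \<open>By Euler's formula each product of zeta values carries the same sign and the
    same power of 2 pi, so these constants leave the sum.\<close>
  also have "(\<Sum>i<N. t ^ (N - i) * (Z (Suc i) * Z (N - i))) =
      (\<Sum>i<N. - (1 / 4 * (-1) ^ N * p ^ (2 * N + 2)) * (t ^ (N - i) * (\<beta> (N - i) * \<beta> (Suc i))))"
  proof (intro sum.cong refl)
    fix i assume "i \<in> {..<N}"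
    then obtain l where l: "N = Suc (i + l)"
      using less_imp_Suc_add by blast
    have "Z (Suc i) * Z (N - i) = (1 / 4 * ((-1) ^ Suc (Suc i) * (-1) ^ Suc (N - i)) * (p ^ (2 * Suc i) * p ^ (2 * (N - i)))) * (\<beta> (Suc i) * \<beta> (N - i))"
      using l by (subst (1 2) Z) auto
    also have "(-1) ^ Suc (Suc i) * (-1) ^ Suc (N - i) = (-1 :: complex) ^ Suc N"
      by (simp add: l flip: power_add)
    also have "p ^ (2 * Suc i) * p ^ (2 * (N - i)) = p ^ (2 * N + 2)"
      by (simp add: l flip: power_add)
    finally show "t ^ (N - i) * (Z (Suc i) * Z (N - i)) = - (1 / 4 * (-1) ^ N * p ^ (2 * N + 2)) * (t ^ (N - i) * (\<beta> (N - i) * \<beta> (Suc i)))"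
      by (simp add: mult_ac)
  qed
  also have "\<dots> = - (1 / 4 * (-1) ^ N * p ^ (2 * N + 2)) * (\<Sum>j=1..N. t ^ j * (\<beta> j * \<beta> (Suc N - j)))"
    unfolding sum_distrib_left [symmetric]
    by (intro arg_cong2[of _ _ _ _ "(*)"] refl sum.reindex_bij_witness[of _ "\<lambda>j. N - j" "\<lambda>i. N - i"])
       (auto simp: Suc_diff_le)
  also have "Z (Suc N) = 1 / 2 * (-1) ^ N * p ^ (2 * N + 2) * \<beta> (Suc N)"
    by (subst Z) auto
  also have "1 / 2 * (-1) ^ N * p ^ (2 * N + 2) * \<beta> (Suc N) + t ^ Suc N * (1 / 2 * (-1) ^ N * p ^ (2 * N + 2) * \<beta> (Suc N)) +
      2 * - (- (1 / 4 * (-1) ^ N * p ^ (2 * N + 2)) * (\<Sum>j=1..N. t ^ j * (\<beta> j * \<beta> (Suc N - j)))) =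
      1 / 2 * (-1) ^ N * p ^ (2 * N + 2) * (\<beta> (Suc N) + t ^ Suc N * \<beta> (Suc N) + (\<Sum>j=1..N. t ^ j * (\<beta> j * \<beta> (Suc N - j))))"
    by (simp add: algebra_simps)
  \<comment> \<open>The two zeta(2N + 2) terms become the ends \<open>j = 0\<close> and
    \<open>j = N + 1\<close> of the Bernoulli convolution because \<beta> 0 = 1, read off from the
    generating function at 0.\<close>
  also have "\<beta> 0 = 1"
    using bernoulli_sums_complex[of 0] powser_sums_zero_iff[of "\<lambda>n. of_real (bernoulli n) / fact n :: complex" 1]
    by (simp add: \<beta>_def)
  hence "\<beta> (Suc N) + t ^ Suc N * \<beta> (Suc N) + (\<Sum>j=1..N. t ^ j * (\<beta> j * \<beta> (Suc N - j))) =
      (\<Sum>j\<le>Suc N. t ^ j * (\<beta> j * \<beta> (Suc N - j)))"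
    unfolding atMost_atLeast0 by (simp add: sum.atLeast_Suc_atMost add_ac)
  also have "1 / 2 * (-1) ^ N * p ^ (2 * N + 2) * \<dots> = of_real pi * ((-1) ^ N * p ^ (2 * N + 1) * (\<Sum>j\<le>Suc N. t ^ j * (\<beta> j * \<beta> (Suc N - j))))"
    by (simp add: p_def)
  finally have "\<tau> * (cot_series N \<tau> - \<tau> ^ (2 * N) * cot_series N (- 1 / \<tau>)) =
      (-1) ^ N * p ^ (2 * N + 1) * (\<Sum>j\<le>Suc N. t ^ j * (\<beta> j * \<beta> (Suc N - j)))"
    by (subst (asm) mult_left_cancel) simp_all
  thus ?thesis
    by (simp add: p_def \<beta>_def t_def)
qed

section \<open>Cotangent series as zeta and S series\<close>

text \<open>In the upper half plane exp(-2 i z) is the large exponential. Divided by k^n and summed,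
  the constant 1 gives zeta(n) and the fraction gives a series of the type of
  \<open>S_series\<close>.\<close>

lemma cot_conv_exp_minus:
  fixes z :: complex
  assumes "exp (2 * \<i> * z) \<noteq> 1"
  shows "cot z = - \<i> * (1 + 2 / (exp (- 2 * \<i> * z) - 1))"
proof -
  define u where "u = exp (2 * \<i> * z)"
  have u: "u \<noteq> 0" "u \<noteq> 1" "exp (- 2 * \<i> * z) = 1 / u"
    using assms by (simp_all add: u_def exp_minus inverse_eq_divide)
  have "1 / u - 1 = (1 - u) / u"
    using u by (simp add: diff_divide_distrib)
  hence "1 + 2 / (1 / u - 1) = (1 + u) / (1 - u)"
    using u by (simp add: divide_simps)
  moreover have "- \<i> * ((1 + u) / (1 - u)) = \<i> * (u + 1) / (u - 1)"
    by (metis (no_types, opaque_lifting) add.commute minus_diff_eq minus_divide_right mult_minus_left mult_minus_right times_divide_eq_right)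
  ultimately show ?thesis
    using cot_conv_exp[of z] u(3) by (simp add: u_def)
qed

definition alt_series :: "nat \<Rightarrow> real" where
  "alt_series n = (\<Sum>k. 1 / (real (Suc k) ^ n * ((-1) ^ Suc k * exp (pi * real (Suc k)) - 1)))"

definition zeta_real :: "nat \<Rightarrow> real" where
  "zeta_real n = (\<Sum>k. 1 / real (Suc k) ^ n)"

lemma sums_S_series:
  assumes "r > 0"
  shows "(\<lambda>k. 1 / (real (Suc k) ^ n * (exp (pi * r * real (Suc k)) - 1))) sums S_series n r"
  unfolding S_series_def using summable_S_series[OF assms] by (rule summable_sums)

lemma sums_zeta_real:
  assumes "n \<ge> 2"
  shows "(\<lambda>k. 1 / real (Suc k) ^ n) sums zeta_real n"
  unfolding zeta_real_def
  by (intro summable_sums summable_on_imp_summable summable_on_inverse_power assms)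

text \<open>Write K = k + 1 and x = e^(pi K). For odd K the term is 1 / (-x - 1) = 2 / (x^2 - 1) - 1
  / (x - 1). Using this expression for all K requires the correction 2 / (x - 1) - 2 / (x^2 - 1) at
  even K, and a sum over K = 2L rescales to \<open>S_series n (2 * r) / 2 ^ n\<close>.\<close>

lemma alt_series_sums:
  "(\<lambda>k. 1 / (real (Suc k) ^ n * ((-1) ^ Suc k * exp (pi * real (Suc k)) - 1))) sums
     (2 / 2 ^ n * (S_series n 2 - S_series n 4) + 2 * S_series n 2 - S_series n 1)"
proof -
  define f where "f = (\<lambda>r k. 1 / (real (Suc k) ^ n * (exp (pi * r * real (Suc k)) - 1)))"
  have f: "f r sums S_series n r" if "r > 0" for r
    unfolding f_def using sums_S_series[OF that] .
  \<comment> \<open>The series is indexed from 0, so \<open>odd k\<close> selects the even values of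
    \<open>Suc k\<close>.\<close>
  have even: "(\<lambda>k. if odd k then f r k else 0) sums (S_series n (2 * r) / 2 ^ n)" if "r > 0" for r
  proof (subst sums_mono_reindex [where g = "\<lambda>k. 2 * k + 1", symmetric])
    show "strict_mono (\<lambda>k::nat. 2 * k + 1)"
      by (simp add: strict_mono_def)
    show "(if odd k then f r k else 0) = 0" if "k \<notin> range (\<lambda>k::nat. 2 * k + 1)" for k
      using that by (auto elim!: oddE)
    have "(\<lambda>k. f (2 * r) k / 2 ^ n) sums (S_series n (2 * r) / 2 ^ n)"
      using that by (intro sums_divide f) auto
    moreover have "f (2 * r) k / 2 ^ n = (if odd (2 * k + 1) then f r (2 * k + 1) else 0)" for k
    proof -
      have "real (Suc (2 * k + 1)) = 2 * real (Suc k)" "odd (2 * k + 1)" by simp_all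
      thus ?thesis
        by (simp only: f_def power_mult_distrib if_True) (simp add: mult_ac del: of_nat_Suc)
    qed
    ultimately show "(\<lambda>k. if odd (2 * k + 1) then f r (2 * k + 1) else 0) sums (S_series n (2 * r) / 2 ^ n)"
      by (simp only:)
  qed
  have "(\<lambda>k. 2 * (if odd k then f 1 k else 0) - 2 * (if odd k then f 2 k else 0) + 2 * f 2 k - f 1 k) sums
     (2 * (S_series n (2 * 1) / 2 ^ n) - 2 * (S_series n (2 * 2) / 2 ^ n) + 2 * S_series n 2 - S_series n 1)"
    by (intro sums_add sums_diff sums_mult even f) auto
  moreover have "2 * (if odd k then f 1 k else 0) - 2 * (if odd k then f 2 k else 0) + 2 * f 2 k - f 1 k =
      1 / (real (Suc k) ^ n * ((-1) ^ Suc k * exp (pi * real (Suc k)) - 1))" for k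
  proof (cases "odd k")
    case True
    thus ?thesis by (simp add: f_def)
  next
    case False
    define x where "x = exp (pi * real (Suc k))"
    have x: "x > 1" by (simp add: x_def)
    have x2: "exp (pi * 2 * real (Suc k)) = x\<^sup>2"
      by (simp add: x_def mult_ac flip: exp_double)
    define c where "c = 1 / real (Suc k) ^ n"
    have sq: "x\<^sup>2 - 1 = (x + 1) * (x - 1)"
      by (simp add: algebra_simps power2_eq_square)
    have "2 * (c / (x\<^sup>2 - 1)) - c / (x - 1) = c * (2 / ((x + 1) * (x - 1)) - 1 / (x - 1))"
      unfolding sq by (simp add: right_diff_distrib)
    also have "2 / ((x + 1) * (x - 1)) - 1 / (x - 1) = 1 / (- x - 1)"
    proof -
      have "1 / (x - 1) = (x + 1) / ((x + 1) * (x - 1))" using x by simp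
      hence "2 / ((x + 1) * (x - 1)) - 1 / (x - 1) = (2 - (x + 1)) / ((x + 1) * (x - 1))"
        by (simp only: diff_divide_distrib)
      also have "\<dots> = - (x - 1) / ((x + 1) * (x - 1))" by simp
      also have "\<dots> = - 1 / (x + 1)" using x by (simp del: minus_diff_eq)
      also have "\<dots> = 1 / (- x - 1)"
        by (metis minus_divide_divide minus_diff_eq minus_add_distrib add.inverse_inverse uminus_add_conv_diff diff_minus_eq_add add.commute)
      finally show ?thesis .
    qed
    finally show ?thesis
      using False unfolding f_def x2 by (simp add: c_def x_def [symmetric] del: of_nat_Suc)
  qed
  ultimately show ?thesis
    by (simp add: right_diff_distrib diff_divide_distrib)
qed

lemma alt_series_eq:
  "alt_series n = 2 / 2 ^ n * (S_series n 2 - S_series n 4) + 2 * S_series n 2 - S_series n 1"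
  using alt_series_sums[of n] by (simp add: alt_series_def sums_iff)

text \<open>Common evaluation for all the points used: the sequence \<open>x\<close> holds the
  exponentials exp(-2 pi i k \<tau>), and their being real makes the cotangent series purely
  imaginary.\<close>

lemma cot_series_conv_sums:
  fixes \<tau> :: complex and x :: "nat \<Rightarrow> real"
  assumes \<tau>: "\<tau> \<noteq> 0" "Re (\<tau>\<^sup>2) \<le> 0" and N: "N \<ge> 1"
  assumes x: "\<And>k. exp (- 2 * \<i> * of_real pi * (of_nat (Suc k) * \<tau>)) = of_real (x k)" "\<And>k. x k \<noteq> 1"
  assumes S: "(\<lambda>k. 1 / (real (Suc k) ^ (2 * N + 1) * (x k - 1))) sums S"
  shows "cot_series N \<tau> = - \<i> * of_real (zeta_real (2 * N + 1) + 2 * S)"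
proof -
  let ?n = "2 * N + 1"
  have "(\<lambda>k. cot (of_real pi * (of_nat (Suc k) * \<tau>)) / of_nat (Suc k) ^ ?n) sums cot_series N \<tau>"
    unfolding cot_series_def using cot_series_has_sum[OF \<tau> N]
    by (metis (no_types, lifting) has_sum_imp_sums infsumI)
  moreover have "(\<lambda>k. - \<i> * of_real (1 / real (Suc k) ^ ?n + 2 * (1 / (real (Suc k) ^ ?n * (x k - 1))))) sums
      (- \<i> * of_real (zeta_real ?n + 2 * S))"
    using N by (intro sums_mult sums_of_real sums_add S sums_zeta_real) auto
  moreover have "- \<i> * of_real (1 / real (Suc k) ^ ?n + 2 * (1 / (real (Suc k) ^ ?n * (x k - 1)))) =
      cot (of_real pi * (of_nat (Suc k) * \<tau>)) / of_nat (Suc k) ^ ?n" for k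
  proof -
    let ?z = "of_real pi * (of_nat (Suc k) * \<tau>)"
    have e: "exp (- 2 * \<i> * ?z) = of_real (x k)"
      using x(1)[of k] by (simp only: mult.assoc)
    have "exp (2 * \<i> * ?z) = inverse (of_real (x k))"
      unfolding e [symmetric] by (simp add: exp_minus)
    hence "exp (2 * \<i> * ?z) \<noteq> 1"
      using x(2)[of k] by (metis inverse_eq_1_iff of_real_eq_1_iff)
    hence "cot ?z = - \<i> * (1 + 2 / (of_real (x k) - 1))"
      unfolding e [symmetric] by (rule cot_conv_exp_minus)
    moreover have "- \<i> * of_real (1 / P + 2 * (1 / (P * (y - 1)))) = - \<i> * (1 + 2 / (of_real y - 1)) / of_real P" for P y :: real
      by (simp add: add_divide_distrib diff_divide_distrib distrib_left mult.commute)
    ultimately show ?thesis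
      by (simp only: of_real_power of_real_of_nat_eq)
  qed
  ultimately show ?thesis
    by (metis (no_types, lifting) sums_cong sums_unique2)
qed

lemma cot_series_imaginary:
  assumes "r > 0" "N \<ge> 1"
  shows "cot_series N (\<i> * of_real (r / 2)) = - \<i> * of_real (zeta_real (2 * N + 1) + 2 * S_series (2 * N + 1) r)"
proof (rule cot_series_conv_sums)
  show "(\<lambda>k. 1 / (real (Suc k) ^ (2 * N + 1) * (exp (pi * r * real (Suc k)) - 1))) sums S_series (2 * N + 1) r"
    using assms by (intro sums_S_series)
  show "exp (- 2 * \<i> * of_real pi * (of_nat (Suc k) * (\<i> * of_real (r / 2)))) = of_real (exp (pi * r * real (Suc k)))" for k
  proof -
    have "- 2 * \<i> * of_real pi * (of_nat (Suc k) * (\<i> * of_real (r / 2))) = of_real (pi * r * real (Suc k))"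
      by (simp add: complex_eq_iff algebra_simps)
    thus ?thesis by (simp only: exp_of_real)
  qed
  show "exp (pi * r * real (Suc k)) \<noteq> 1" for k
    using assms by simp
qed (use assms in \<open>auto simp: power2_eq_square\<close>)

text \<open>The shift by -1 changes nothing, cot(pi z) having period 1; the value is that at
  i.\<close>

lemma cot_series_minus_one_plus_i:
  assumes "N \<ge> 1"
  shows "cot_series N (- 1 + \<i>) = - \<i> * of_real (zeta_real (2 * N + 1) + 2 * S_series (2 * N + 1) 2)"
proof (rule cot_series_conv_sums)
  show "(\<lambda>k. 1 / (real (Suc k) ^ (2 * N + 1) * (exp (pi * 2 * real (Suc k)) - 1))) sums S_series (2 * N + 1) 2"
    by (intro sums_S_series) auto
  show "exp (- 2 * \<i> * of_real pi * (of_nat (Suc k) * (- 1 + \<i>))) = of_real (exp (pi * 2 * real (Suc k)))" for k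
  proof -
    have "- 2 * \<i> * of_real pi * (of_nat (Suc k) * (- 1 + \<i>)) =
        of_real (pi * 2 * real (Suc k)) + of_real (2 * real (Suc k) * pi) * \<i>"
      by (simp add: complex_eq_iff algebra_simps)
    moreover have "exp (of_real (2 * real (Suc k) * pi) * \<i>) = 1"
      by (rule exp_integer_2pi) simp
    ultimately show ?thesis by (simp only: exp_of_real exp_add mult_1_right)
  qed
qed (use assms in \<open>auto simp: complex_eq_iff power2_eq_square\<close>)

text \<open>The real part 1/2 contributes exp(-pi i k) = (-1)^k, which is the sign in
  \<open>alt_series\<close>.\<close>

lemma cot_series_half_one_plus_i:
  assumes "N \<ge> 1"
  shows "cot_series N ((1 + \<i>) / 2) = - \<i> * of_real (zeta_real (2 * N + 1) + 2 * alt_series (2 * N + 1))"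
proof (rule cot_series_conv_sums)
  show "(\<lambda>k. 1 / (real (Suc k) ^ (2 * N + 1) * ((-1) ^ Suc k * exp (pi * real (Suc k)) - 1))) sums alt_series (2 * N + 1)"
    using alt_series_sums[of "2 * N + 1"] unfolding alt_series_eq .
  show "exp (- 2 * \<i> * of_real pi * (of_nat (Suc k) * ((1 + \<i>) / 2))) = of_real ((-1) ^ Suc k * exp (pi * real (Suc k)))" for k
  proof -
    have "- 2 * \<i> * of_real pi * (of_nat (Suc k) * ((1 + \<i>) / 2)) =
        of_real (pi * real (Suc k)) + of_nat (Suc k) * (- (of_real pi * \<i>))"
      by (simp add: complex_eq_iff algebra_simps) (simp add: field_simps)
    moreover have "exp (of_nat (Suc k) * (- (of_real pi * \<i>))) = (-1) ^ Suc k"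
      unfolding exp_of_nat_mult by (simp add: exp_minus)
    ultimately show ?thesis
      by (simp only: exp_of_real [symmetric] exp_add of_real_mult of_real_power of_real_minus of_real_1 mult.commute)
  qed
  show "(-1) ^ Suc k * exp (pi * real (Suc k)) \<noteq> 1" for k
  proof -
    have "\<bar>(-1) ^ Suc k * exp (pi * real (Suc k))\<bar> > 1"
      by (simp add: abs_mult)
    thus ?thesis by auto
  qed
qed (use assms in \<open>auto simp: complex_eq_iff power2_eq_square\<close>)

section \<open>Positivity and decay of the S series\<close>

lemma S_series_pos:
  assumes "r > 0"
  shows "S_series n r > 0"
  unfolding S_series_def
  using assms by (intro suminf_pos summable_S_series) auto

text \<open>Termwise, x = e^(pi r k) becomes x^2, and x^2 - 1 = (x + 1) (x - 1) >= 4 (x - 1). That x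
  >= 4 follows from e^t >= 1 + t with t >= pi > 3.\<close>

lemma S_series_double_le:
  assumes "r \<ge> 1"
  shows "S_series n (2 * r) \<le> S_series n r / 4"
proof (rule sums_le[OF _ sums_S_series sums_divide[OF sums_S_series]])
  fix k
  define x where "x = exp (pi * r * real (Suc k))"
  have "pi * 1 * 1 \<le> pi * r * real (Suc k)"
    using assms by (intro mult_mono) auto
  hence x: "x \<ge> 4"
    using exp_ge_add_one_self[of "pi * r * real (Suc k)"] pi_gt3 unfolding x_def by linarith
  have x2: "exp (pi * (2 * r) * real (Suc k)) = x\<^sup>2"
    by (simp add: x_def mult_ac flip: exp_double)
  have "4 * (x - 1) \<le> (x + 1) * (x - 1)"
    using x by (intro mult_right_mono) auto
  hence "4 * (x - 1) \<le> x\<^sup>2 - 1"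
    by (simp add: algebra_simps power2_eq_square)
  hence "1 / (real (Suc k) ^ n * (x\<^sup>2 - 1)) \<le> 1 / (real (Suc k) ^ n * (4 * (x - 1)))"
    using x by (intro divide_left_mono mult_left_mono mult_pos_pos) auto
  also have "\<dots> = 1 / (real (Suc k) ^ n * (x - 1)) / 4" by simp
  finally show "1 / (real (Suc k) ^ n * (exp (pi * (2 * r) * real (Suc k)) - 1))
      \<le> 1 / (real (Suc k) ^ n * (exp (pi * r * real (Suc k)) - 1)) / 4"
    unfolding x2 x_def .
qed (use assms in auto)

section \<open>The two reciprocity relations, elimination and the sign of E_m\<close>

text \<open>Here \<tau>^2 = -4 yields the weights (-4)^k of \<open>G_sum\<close>, and \<tau>^(4m) =
  16^m.\<close>

lemma reciprocity_at_two_i: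
  assumes "m \<ge> 1"
  defines "n \<equiv> 4 * m + 1"
  shows "(zeta_real n + 2 * S_series n 4) - 16 ^ m * (zeta_real n + 2 * S_series n 1) = 16 ^ m * pi ^ n * G_sum (2 * m)"
proof -
  let ?Z = "zeta_real n"
  define \<tau> where "\<tau> = \<i> * of_real (4 / 2)"
  have n: "n = 2 * (2 * m) + 1" by (simp add: n_def)
  have N: "2 * m \<ge> 1" using assms by simp
  have \<tau>: "\<tau> \<noteq> 0" "\<tau>\<^sup>2 = - 4" "- 1 / \<tau> = \<i> * of_real (1 / 2)" "Re (\<tau>\<^sup>2) \<le> 0"
    by (simp_all add: \<tau>_def complex_eq_iff power2_eq_square Re_divide Im_divide)
  have \<tau>4: "\<tau> ^ (2 * (2 * m)) = 16 ^ m"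
    unfolding power_mult \<tau> by simp
  have "\<tau> * (cot_series (2 * m) \<tau> - \<tau> ^ (2 * (2 * m)) * cot_series (2 * m) (- 1 / \<tau>)) =
      of_real (2 * ((?Z + 2 * S_series n 4) - 16 ^ m * (?Z + 2 * S_series n 1)))"
    unfolding \<tau>(3) \<tau>4 unfolding \<tau>_def cot_series_imaginary[of 4, OF zero_less_numeral N] cot_series_imaginary[of 1, OF zero_less_one N]
    by (simp add: n algebra_simps complex_eq_iff)
  moreover have "(\<Sum>j\<le>2*m+1. (\<tau>\<^sup>2) ^ j * of_real (bernoulli (2 * j) / fact (2 * j) * (bernoulli (2 * (2 * m + 1 - j)) / fact (2 * (2 * m + 1 - j))))) =
      of_real (G_sum (2 * m))"
    unfolding G_sum_def \<tau> of_real_sum atMost_atLeast0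
    by (intro sum.cong refl) (simp add: diff_mult_distrib2)
  ultimately have "complex_of_real (2 * ((?Z + 2 * S_series n 4) - 16 ^ m * (?Z + 2 * S_series n 1))) =
      of_real ((2 * pi) ^ n * G_sum (2 * m))"
    using cot_series_reciprocity[OF \<tau>(1,4) N] by (simp add: n)
  hence "2 * ((?Z + 2 * S_series n 4) - 16 ^ m * (?Z + 2 * S_series n 1)) = (2 * pi) ^ n * G_sum (2 * m)"
    by (simp only: of_real_eq_iff)
  also have "(2 * pi) ^ n = 2 * (16 ^ m * pi ^ n)"
    by (simp add: n_def power_mult_distrib power_mult)
  finally show ?thesis by simp
qed

text \<open>Here \<tau>^2 = -2i, whose even powers are the real numbers (-4)^k and whose odd powers
  are imaginary. Taking real parts thus keeps every second term of the Bernoulli convolution, which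
  is \<open>H_sum\<close>.\<close>

lemma reciprocity_at_minus_one_plus_i:
  assumes "m \<ge> 1"
  defines "n \<equiv> 4 * m + 1"
  shows "(zeta_real n + 2 * S_series n 2) - (-4) ^ m * (zeta_real n + 2 * alt_series n) = 2 * (-4) ^ m * pi ^ n * H_sum m"
proof -
  let ?Z = "zeta_real n"
  define w where "w = (-4 :: real) ^ m"
  define \<tau> where "\<tau> = - 1 + \<i>"
  have w2: "w * w = 16 ^ m" by (simp add: w_def flip: power_mult_distrib)
  have w0: "w \<noteq> 0" by (simp add: w_def)
  have n: "n = 2 * (2 * m) + 1" by (simp add: n_def)
  have N: "2 * m \<ge> 1" using assms by simp
  have \<tau>: "\<tau> \<noteq> 0" "\<tau>\<^sup>2 = - 2 * \<i>" "- 1 / \<tau> = (1 + \<i>) / 2" "Re (\<tau>\<^sup>2) \<le> 0"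
    by (simp_all add: \<tau>_def complex_eq_iff power2_eq_square Re_divide Im_divide)
  have \<tau>4: "\<tau> ^ (2 * (2 * m)) = of_real w"
    unfolding power_mult \<tau> by (simp add: w_def power_mult_distrib)
  define g where "g = (\<lambda>j. bernoulli (2 * j) / fact (2 * j) * (bernoulli (2 * (2 * m + 1 - j)) / fact (2 * (2 * m + 1 - j))))"
  \<comment> \<open>The factor 1 + i is \<tau> times the -i from the cotangent series; its real part
    is 1, so real parts lose nothing on this side.\<close>
  have "\<tau> * (cot_series (2 * m) \<tau> - \<tau> ^ (2 * (2 * m)) * cot_series (2 * m) (- 1 / \<tau>)) =
      (1 + \<i>) * of_real ((?Z + 2 * S_series n 2) - w * (?Z + 2 * alt_series n))"
    unfolding \<tau>(3) \<tau>4 unfolding \<tau>_def cot_series_minus_one_plus_i[OF N] cot_series_half_one_plus_i[OF N]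
    by (simp add: n algebra_simps complex_eq_iff)
  moreover have "\<tau> * (cot_series (2 * m) \<tau> - \<tau> ^ (2 * (2 * m)) * cot_series (2 * m) (- 1 / \<tau>)) =
      of_real ((2 * pi) ^ n) * (\<Sum>j\<le>2*m+1. (\<tau>\<^sup>2) ^ j * of_real (g j))"
    using cot_series_reciprocity[OF \<tau>(1,4) N] unfolding g_def by (simp add: n)
  ultimately have "Re ((1 + \<i>) * of_real ((?Z + 2 * S_series n 2) - w * (?Z + 2 * alt_series n))) =
      Re (of_real ((2 * pi) ^ n) * (\<Sum>j\<le>2*m+1. (\<tau>\<^sup>2) ^ j * of_real (g j)))"
    by (simp only:)
  hence "(?Z + 2 * S_series n 2) - w * (?Z + 2 * alt_series n) = (2 * pi) ^ n * Re (\<Sum>j\<le>2*m+1. (\<tau>\<^sup>2) ^ j * of_real (g j))"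
    by (simp flip: of_real_power)
  also have "Re (\<Sum>j\<le>2*m+1. (\<tau>\<^sup>2) ^ j * of_real (g j)) = (\<Sum>j\<le>Suc (2*m). Re ((- 2 * \<i>) ^ j) * g j)"
    unfolding \<tau>(2) by simp
  also have "\<dots> = (\<Sum>k\<le>m. (-4) ^ k * g (2 * k))"
  proof -
    have "(- 2 * \<i>) ^ (2 * k) = of_real ((-4) ^ k)" for k
      unfolding power_mult by (simp add: power_mult_distrib)
    hence "Re ((- 2 * \<i>) ^ (2 * k)) = (-4) ^ k" "Re ((- 2 * \<i>) ^ Suc (2 * k)) = 0" for k
      by (simp_all flip: of_real_power)
    thus ?thesis
      unfolding sum.in_pairs_0 by simp
  qed
  \<comment> \<open>\<open>H_sum\<close> is weighted by (-4)^(m + k), hence the division; the factor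
    w^2 in (2 pi)^n absorbs it.\<close>
  also have "\<dots> = H_sum m / w"
    unfolding H_sum_def sum_divide_distrib atMost_atLeast0
  proof (intro sum.cong refl)
    fix k assume "k \<in> {0..m}"
    have "2 * (2 * m + 1 - 2 * k) = 4 * m + 2 - 4 * k" "2 * (2 * k) = 4 * k"
      by simp_all
    hence "g (2 * k) = bernoulli (4 * k) * bernoulli (4 * m + 2 - 4 * k) / (fact (4 * k) * fact (4 * m + 2 - 4 * k))"
      by (simp only: g_def times_divide_times_eq)
    thus "(-4) ^ k * g (2 * k) = (-4) ^ (m + k) * (bernoulli (4 * k) * bernoulli (4 * m + 2 - 4 * k)) / (fact (4 * k) * fact (4 * m + 2 - 4 * k)) / w"
      using w0 by (simp add: power_add w_def [symmetric])
  qed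
  also have "(2 * pi) ^ n * (H_sum m / w) = 2 * w * pi ^ n * H_sum m"
  proof -
    have "(2 * pi) ^ n = 2 * (w * w) * pi ^ n"
      by (simp add: n_def power_mult_distrib power_mult w2)
    thus ?thesis using w0 by simp
  qed
  finally show ?thesis by (simp only: w_def)
qed

lemma E_coeff_identity:
  assumes "m \<ge> 1"
  defines "n \<equiv> 4 * m + 1" and "w \<equiv> (-4 :: real) ^ m"
  shows "2 * (1 + 2 * w) * K_coeff m = 1 + w" (is ?A)
    and "E_coeff m * pi ^ n = - w\<^sup>2 * S_series n 1 + 2 * K_coeff m * (2 * w\<^sup>2 - w + 1) * S_series n 2
      + (1 - 4 * K_coeff m) * S_series n 4" (is ?B)
proof -
  have w2: "(16 :: real) ^ m = w\<^sup>2" by (simp add: w_def power2_eq_square flip: power_mult_distrib)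
  have pow: "(4 :: real) ^ (2 * m) = w\<^sup>2" "(2 :: real) ^ (4 * m) = w\<^sup>2" "(2 :: real) ^ (4 * m + 1) = 2 * w\<^sup>2" "(2 :: real) ^ n = 2 * w\<^sup>2"
    by (simp_all add: n_def power_mult w2)
  have "\<bar>w\<bar> = 4 ^ m" by (simp add: w_def power_abs)
  moreover have "(4 :: real) ^ 1 \<le> 4 ^ m" using assms by (intro power_increasing) auto
  ultimately have w: "w \<noteq> 1" "1 + 2 * w \<noteq> 0" by auto
  \<comment> \<open>Numerator and denominator of K_m share the factor 1 - w; cancelling it gives the
    short form of K_m.\<close>
  have "1 + w - 2 * w\<^sup>2 = (1 - w) * (1 + 2 * w)" "1 - w\<^sup>2 = (1 - w) * (1 + w)"
    by (simp_all add: algebra_simps power2_eq_square)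
  hence "K_coeff m = (1 / 2 * ((1 - w) * (1 + w))) / ((1 - w) * (1 + 2 * w))"
    unfolding K_coeff_def pow w_def [symmetric] by (simp only:)
  also have "\<dots> = (1 + w) / (2 * (1 + 2 * w))"
    using w(1) by simp
  finally show A: ?A using w(2) by simp
  define Q where "Q = pi ^ n"
  define G where "G = G_sum (2 * m)"
  define H where "H = H_sum m"
  define K where "K = K_coeff m"
  define Z where "Z = zeta_real n"
  define R where "R = alt_series n"
  define S1 S2 S4 where "S1 = S_series n 1" and "S2 = S_series n 2" and "S4 = S_series n 4"
  have eK: "2 * (1 + 2 * w) * K = 1 + w" using A by (simp add: K_def)
  have e1: "(Z + 2 * S4) - w\<^sup>2 * (Z + 2 * S1) = w\<^sup>2 * Q * G"
    using reciprocity_at_two_i[OF assms(1)] by (simp add: n_def w2 Z_def S1_def S4_def Q_def G_def)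
  have e2: "(Z + 2 * S2) - w * (Z + 2 * R) = 2 * w * Q * H"
    using reciprocity_at_minus_one_plus_i[OF assms(1)] by (simp add: n_def w_def Z_def S2_def R_def Q_def H_def)
  have "w \<noteq> 0" by (simp add: w_def)
  hence e3: "w\<^sup>2 * R = S2 - S4 + 2 * w\<^sup>2 * S2 - w\<^sup>2 * S1"
    using alt_series_eq[of n] unfolding pow R_def S1_def S2_def S4_def by (simp add: field_simps)
  have E: "E_coeff m = w\<^sup>2 / 2 * G - 2 * w\<^sup>2 * K * H - w\<^sup>2 * K * G"
    unfolding E_coeff_def pow by (simp add: G_def H_def K_def)
  \<comment> \<open>The factor 2 (1 + 2w) clears the denominator of K_m. What remains is w times
    \<open>e1\<close> minus w (1 + w) times \<open>e2\<close>, where Z cancels, followed by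
    \<open>e3\<close> to remove R.\<close>
  have "2 * (1 + 2 * w) * (E_coeff m * Q - (- w\<^sup>2 * S1 + 2 * K * (2 * w\<^sup>2 - w + 1) * S2 + (1 - 4 * K) * S4)) = 0"
  proof -
    have "2 * (1 + 2 * w) * (E_coeff m * Q) = (1 + 2 * w) * w\<^sup>2 * G * Q - (2 * (1 + 2 * w) * K) * (2 * w\<^sup>2 * H + w\<^sup>2 * G) * Q"
      unfolding E by (simp add: field_simps)
    also have "\<dots> = w\<^sup>2 * (w * G - 2 * (1 + w) * H) * Q"
      unfolding eK by (simp add: algebra_simps)
    also have "\<dots> = w * (w\<^sup>2 * Q * G) - w * (1 + w) * (2 * w * Q * H)"
      by (simp add: algebra_simps power2_eq_square)
    also have "\<dots> = w * (2 * S4 - 2 * w\<^sup>2 * S1) - w * (1 + w) * 2 * S2 + 2 * (1 + w) * (w\<^sup>2 * R)"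
      unfolding e1 [symmetric] e2 [symmetric] by (simp add: algebra_simps power2_eq_square)
    also have "\<dots> = - 2 * (1 + 2 * w) * w\<^sup>2 * S1 + 2 * (1 + w) * (2 * w\<^sup>2 - w + 1) * S2 - 2 * S4"
      unfolding e3 by (simp add: algebra_simps power2_eq_square)
    also have "\<dots> = - 2 * (1 + 2 * w) * w\<^sup>2 * S1 + 2 * (2 * (1 + 2 * w) * K) * (2 * w\<^sup>2 - w + 1) * S2
        + (2 * (1 + 2 * w) - 4 * (2 * (1 + 2 * w) * K)) * S4"
      unfolding eK by (simp add: algebra_simps)
    finally show ?thesis by (simp add: algebra_simps)
  qed
  with w(2) show ?B
    by (simp add: Q_def K_def S1_def S2_def S4_def)
qed

lemma E_coeff_neg:
  assumes "m \<ge> 1"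
  shows "E_coeff m < 0"
proof -
  define n where "n = 4 * m + 1"
  define w where "w = (-4 :: real) ^ m"
  define K where "K = K_coeff m"
  define S1 S2 S4 where "S1 = S_series n 1" and "S2 = S_series n 2" and "S4 = S_series n 4"
  have S: "S1 > 0" "S2 > 0" "S4 > 0" "S2 \<le> S1 / 4" "S4 \<le> S2 / 4"
    using S_series_double_le[of 1 n] S_series_double_le[of 2 n]
    by (simp_all add: S1_def S2_def S4_def S_series_pos)
  have "\<bar>w\<bar> = 4 ^ m" by (simp add: w_def power_abs)
  moreover have "(4 :: real) \<le> 4 ^ m" using assms power_increasing[of 1 m "4 :: real"] by simp
  ultimately have w: "w \<ge> 4 \<or> w \<le> -4" by linarith
  have eK: "2 * (1 + 2 * w) * K = 1 + w"
    using E_coeff_identity(1)[OF assms] by (simp add: K_def w_def)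
  hence K_eq: "K = (1 + w) / (2 * (1 + 2 * w))"
    using w by (auto simp: field_simps)
  \<comment> \<open>K = 1/4 + 1 / (4 (1 + 2w)) with |w| >= 4 lies between 3/14 and 5/18.\<close>
  have K: "0 \<le> K" "K \<le> 3 / 10"
    using w by (auto simp: K_eq field_simps zero_le_divide_iff)
  have "4 * \<bar>w\<bar> \<le> \<bar>w\<bar> * \<bar>w\<bar>"
    using w by (intro mult_right_mono) auto
  hence w2: "4 * \<bar>w\<bar> \<le> w\<^sup>2" by (simp add: power2_eq_square)
  define X A B where "X = w\<^sup>2 * S1" and "A = 2 * K * (2 * w\<^sup>2 - w + 1) * S2" and "B = (1 - 4 * K) * S4"
  \<comment> \<open>The factor 3 w^2 comes from |w| <= w^2 / 4 and 1 <= |w| / 4. Since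
    \<open>S2\<close> is at most \<open>S1 / 4\<close>, the total 2 * 3/10 * 3/4 = 9/20 is well
    below 1.\<close>
  have "2 * K * ((2 * w\<^sup>2 - w + 1) * S2) \<le> 2 * (3 / 10) * (3 * w\<^sup>2 * (S1 / 4))"
    using K S w w2 by (intro mult_mono) auto
  hence "A \<le> 9 / 20 * X" by (simp add: A_def X_def mult_ac)
  moreover have "(1 - 4 * K) * S4 \<le> 1 * (S1 / 16)"
    using K S by (intro mult_mono) auto
  hence "B \<le> S1 / 16" by (simp add: B_def)
  moreover have "16 * S1 \<le> w\<^sup>2 * S1"
    using w w2 S by (intro mult_right_mono) auto
  hence "16 * S1 \<le> X" by (simp add: X_def)
  ultimately have "- X + A + B < 0"
    using S(1) by linarith
  hence "- w\<^sup>2 * S1 + 2 * K * (2 * w\<^sup>2 - w + 1) * S2 + (1 - 4 * K) * S4 < 0"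
    by (simp add: X_def A_def B_def)
  hence "E_coeff m * pi ^ n < 0"
    using E_coeff_identity(2)[OF assms] by (simp add: K_def w_def S1_def S2_def S4_def n_def)
  thus ?thesis
    by (simp add: mult_less_0_iff)
qed

theorem mainTheorem3:
  fixes m :: nat
  assumes "m \<ge> 1"
  shows "pi ^ (4*m + 1) =
    - (4 ^ (2*m) / E_coeff m) * S_series (4*m + 1) 1
    + 2 * K_coeff m * (2 ^ (4*m + 1) - (-4) ^ m + 1) / E_coeff m * S_series (4*m + 1) 2
    + (1 - 4 * K_coeff m) / E_coeff m * S_series (4*m + 1) 4"
proof -
  have pow: "((-4 :: real) ^ m)\<^sup>2 = 4 ^ (2 * m)" "2 * (4 :: real) ^ (2 * m) = 2 ^ (4 * m + 1)"
    by (simp_all add: power_mult power2_eq_square flip: power_mult_distrib)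
  have "pi ^ (4*m + 1) = E_coeff m * pi ^ (4*m + 1) / E_coeff m"
    using E_coeff_neg[OF assms] by simp
  also have "\<dots> = (- (4 ^ (2*m)) * S_series (4*m + 1) 1
      + 2 * K_coeff m * (2 ^ (4*m + 1) - (-4) ^ m + 1) * S_series (4*m + 1) 2
      + (1 - 4 * K_coeff m) * S_series (4*m + 1) 4) / E_coeff m"
    unfolding E_coeff_identity(2)[OF assms] pow ..
  finally show ?thesis
    by (simp only: add_divide_distrib times_divide_eq_left minus_divide_left)
qed

end
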